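(* Let $N\ge 1$ be an integer, $p\ge 2$, $\alpha\in(0,N)$, $h:\mathbb{Z}^N\to\mathbb{R}$ and $f:\mathbb{R}\to\mathbb{R}$, with $F(t)=\int_0^t f(s)\,ds$. Assume: (1) there is a constant $h_0>0$ such that $h(x)\ge h_0$ for all $x\in\mathbb{Z}^N$; (2) there exists a point $x_0\in\mathbb{Z}^N$ such that $h(x)\to\infty$ as $|x-x_0|\to\infty$; (3) $f$ is continuous and $f(t)=o(|t|^{p-1})$ as $t\to 0$; (4) there exist constants $C>0$ and $\tau>\frac{(N+\alpha)p}{2N}$ such that $|f(t)|\le C(1+|t|^{\tau-1})$ for all $t\in\mathbb{R}$; (5) there exists a constant $\theta>p$ such that $0\le\theta F(t)\le 2f(t)t$ for all $t\in\mathbb{R}$; (6) for any $u\in H\setminus\{0\}$, the function $t\mapsto \frac{1}{t^p}\int_{\mathbb{Z}^N}(R_\alpha * F(tu))f(tu)u\,d\mu$ is strictly increasing on $(0,\infty)$. Then the equation $$-\Delta_p u+h(x)|u|^{p-2}u=(R_\alpha * F(u))f(u)\quad\text{on }\mathbb{Z}^N$$ has a ground state solution.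
   Context: $\mathbb{Z}^N$ is the integer lattice graph: $x\sim y$ iff $\sum_{i=1}^N|x_i-y_i|=1$; $|x-y|$ denotes the graph distance. $\mu$ is the counting measure, so $\int_{\mathbb{Z}^N}g\,d\mu=\sum_{x\in\mathbb{Z}^N}g(x)$. For $u,v:\mathbb{Z}^N\to\mathbb{R}$: $\nabla u\nabla v(x):=\frac12\sum_{y\sim x}(u(y)-u(x))(v(y)-v(x))$, $|\nabla u|(x)=\big(\frac12\sum_{y\sim x}(u(y)-u(x))^2\big)^{1/2}$, and $$\Delta_p u(x)=\frac12\sum_{y\sim x}\big(|\nabla u|^{p-2}(y)+|\nabla u|^{p-2}(x)\big)(u(y)-u(x)).$$ $R_\alpha$ is the Green's function of the discrete fractional Laplacian: $$R_\alpha(x,y)=\frac{K_\alpha}{(2\pi)^N}\int_{[0,2\pi]^N}e^{i(x-y)\cdot k}\,\mu(k)^{-\alpha/2}\,dk,\quad K_\alpha=\frac1{(2\pi)^N}\int_{[0,2\pi]^N}\mu(k)^{\alpha/2}\,dk,\quad \mu(k)=2N-2\sum_{j=1}^N\cos(k_j)$$ (here $\mu(k)$ is a function, not the counting measure), and $(R_\alpha * g)(x)=\sum_{y\in\mathbb{Z}^N}R_\alpha(x,y)g(y)$. $W^{1,p}(\mathbb{Z}^N)$ is the completion of the finitely supported functions with respect to $\|u\|_{W^{1,p}}=\big(\int_{\mathbb{Z}^N}(|\nabla u|^p+|u|^p)\,d\mu\big)^{1/p}$. $H=\{u\in W^{1,p}(\mathbb{Z}^N):\int_{\mathbb{Z}^N}h|u|^p\,d\mu<\infty\}$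 with norm $\|u\|=\big(\int_{\mathbb{Z}^N}(|\nabla u|^p+h|u|^p)\,d\mu\big)^{1/p}$. The energy functional is $J:H\to\mathbb{R}$, $$J(u)=\frac1p\|u\|^p-\frac12\int_{\mathbb{Z}^N}(R_\alpha * F(u))F(u)\,d\mu,$$ which is $C^1$ with $$\langle J'(u),\phi\rangle=\int_{\mathbb{Z}^N}\big(|\nabla u|^{p-2}\nabla u\nabla\phi+h|u|^{p-2}u\phi\big)d\mu-\int_{\mathbb{Z}^N}(R_\alpha * F(u))f(u)\phi\,d\mu,\quad \phi\in H.$$ The Nehari manifold is $\mathcal{M}=\{v\in H\setminus\{0\}:\langle J'(v),v\rangle=0\}$. A ground state solution of the equation is a $u\in H\setminus\{0\}$ with $J'(u)=0$ and $J(u)=\inf_{v\in\mathcal{M}}J(v)$. *)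

theory Defs
  imports "HOL-Analysis.Analysis" "HOL-Library.Landau_Symbols"
begin

(* Z^N is int ^ 'n with N = CARD('n); integrals against the counting measure are infsum's.
   Powers with real exponent are powr.  Since 0 powr 0 = 0, for p = 2 the factors |grad u|^(p-2)
   and |u|^(p-2) are 0 instead of 1 where their base vanishes; everywhere below they are then
   multiplied by 0 (if |grad u|(x) = 0, then u(y) = u(x) for all neighbours y of x). *)

definition lattice_adj :: "int ^ 'n \<Rightarrow> int ^ 'n \<Rightarrow> bool" where
  "lattice_adj x y \<longleftrightarrow> (\<Sum>i\<in>UNIV. \<bar>x $ i - y $ i\<bar>) = 1"

definition lattice_dist :: "int ^ 'n \<Rightarrow> int ^ 'n \<Rightarrow> nat" where
  "lattice_dist x y = (LEAST n. (lattice_adj ^^ n) x y)"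

definition grad_prod :: "(int ^ 'n \<Rightarrow> real) \<Rightarrow> (int ^ 'n \<Rightarrow> real) \<Rightarrow> int ^ 'n \<Rightarrow> real" where
  "grad_prod u v x = 1/2 * (\<Sum>y | lattice_adj x y. (u y - u x) * (v y - v x))"

definition grad_norm :: "(int ^ 'n \<Rightarrow> real) \<Rightarrow> int ^ 'n \<Rightarrow> real" where
  "grad_norm u x = sqrt (1/2 * (\<Sum>y | lattice_adj x y. (u y - u x)\<^sup>2))"

definition p_laplacian :: "real \<Rightarrow> (int ^ 'n \<Rightarrow> real) \<Rightarrow> int ^ 'n \<Rightarrow> real" where
  "p_laplacian p u x =
     1/2 * (\<Sum>y | lattice_adj x y.
              (grad_norm u y powr (p - 2) + grad_norm u x powr (p - 2)) * (u y - u x))"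

definition lap_symbol :: "real ^ 'n \<Rightarrow> real" where
  "lap_symbol k = 2 * real CARD('n) - 2 * (\<Sum>j\<in>UNIV. cos (k $ j))"

abbreviation period_cube :: "(real ^ 'n) set" where
  "period_cube \<equiv> cbox 0 (\<chi> i. 2 * pi)"

definition K_const :: "'n::finite itself \<Rightarrow> real \<Rightarrow> real" where
  "K_const _ \<alpha> = 1 / (2 * pi) ^ CARD('n) *
     (LINT k:(period_cube :: (real ^ 'n) set)|lborel. lap_symbol k powr (\<alpha> / 2))"

(* The integral is real, by the substitution k_j -> 2 pi - k_j, so Re only changes the type.
   The value 0 of 0 powr (- \<alpha> / 2) concerns only the corners of the cube, a null set. *)
definition green :: "real \<Rightarrow> int ^ 'n \<Rightarrow> int ^ 'n \<Rightarrow> real" where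
  "green \<alpha> x y = K_const TYPE('n) \<alpha> / (2 * pi) ^ CARD('n) *
     Re (LINT k:(period_cube :: (real ^ 'n) set)|lborel.
           exp (\<i> * complex_of_real (\<Sum>j\<in>UNIV. real_of_int (x $ j - y $ j) * k $ j)) *
           complex_of_real (lap_symbol k powr (- \<alpha> / 2)))"

definition green_conv :: "real \<Rightarrow> (int ^ 'n \<Rightarrow> real) \<Rightarrow> int ^ 'n \<Rightarrow> real" where
  "green_conv \<alpha> g x = (\<Sum>\<^sub>\<infinity>y. green \<alpha> x y * g y)"

definition primitive :: "(real \<Rightarrow> real) \<Rightarrow> real \<Rightarrow> real" where
  "primitive f t = (LBINT s=ereal 0..ereal t. f s)"

definition W1p_norm :: "real \<Rightarrow> (int ^ 'n \<Rightarrow> real) \<Rightarrow> real" where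
  "W1p_norm p u = (\<Sum>\<^sub>\<infinity>x. grad_norm u x powr p + \<bar>u x\<bar> powr p) powr (1 / p)"

(* The completion of the finitely supported functions, realised as a space of functions: since
   the norm dominates each |u(x)|, Cauchy sequences converge pointwise, and the completion is the
   closure in the functions of finite norm.  The summability condition says that u - \<phi> k has
   finite norm (a divergent infsum would be 0). *)
definition W1p :: "real \<Rightarrow> (int ^ 'n \<Rightarrow> real) set" where
  "W1p p = {u. \<exists>\<phi>. (\<forall>k::nat. finite {x. \<phi> k x \<noteq> 0}) \<and>
      (\<forall>k. (\<lambda>x. grad_norm (\<lambda>z. u z - \<phi> k z) x powr p + \<bar>u x - \<phi> k x\<bar> powr p)
             summable_on UNIV) \<and>
      (\<lambda>k. W1p_norm p (\<lambda>z. u z - \<phi> k z)) \<longlonglongrightarrow> 0}"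

definition H_space :: "real \<Rightarrow> (int ^ 'n \<Rightarrow> real) \<Rightarrow> (int ^ 'n \<Rightarrow> real) set" where
  "H_space p h = {u \<in> W1p p. (\<lambda>x. h x * \<bar>u x\<bar> powr p) summable_on UNIV}"

definition H_norm :: "real \<Rightarrow> (int ^ 'n \<Rightarrow> real) \<Rightarrow> (int ^ 'n \<Rightarrow> real) \<Rightarrow> real" where
  "H_norm p h u = (\<Sum>\<^sub>\<infinity>x. grad_norm u x powr p + h x * \<bar>u x\<bar> powr p) powr (1 / p)"

definition energy ::
  "real \<Rightarrow> real \<Rightarrow> (int ^ 'n \<Rightarrow> real) \<Rightarrow> (real \<Rightarrow> real) \<Rightarrow> (int ^ 'n \<Rightarrow> real) \<Rightarrow> real" where
  "energy p \<alpha> h f u =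
     1 / p * H_norm p h u powr p
     - 1/2 * (\<Sum>\<^sub>\<infinity>x. green_conv \<alpha> (\<lambda>y. primitive f (u y)) x * primitive f (u x))"

(* The pairing of J'(u) with \<phi>, for J = energy p \<alpha> h f. *)
definition energy_deriv ::
  "real \<Rightarrow> real \<Rightarrow> (int ^ 'n \<Rightarrow> real) \<Rightarrow> (real \<Rightarrow> real) \<Rightarrow> (int ^ 'n \<Rightarrow> real) \<Rightarrow>
   (int ^ 'n \<Rightarrow> real) \<Rightarrow> real" where
  "energy_deriv p \<alpha> h f u \<phi> =
     (\<Sum>\<^sub>\<infinity>x. grad_norm u x powr (p - 2) * grad_prod u \<phi> x
            + h x * \<bar>u x\<bar> powr (p - 2) * u x * \<phi> x)
     - (\<Sum>\<^sub>\<infinity>x. green_conv \<alpha> (\<lambda>y. primitive f (u y)) x * f (u x) * \<phi> x)"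

definition nehari ::
  "real \<Rightarrow> real \<Rightarrow> (int ^ 'n \<Rightarrow> real) \<Rightarrow> (real \<Rightarrow> real) \<Rightarrow> (int ^ 'n \<Rightarrow> real) set" where
  "nehari p \<alpha> h f = {v \<in> H_space p h - {\<lambda>_. 0}. energy_deriv p \<alpha> h f v v = 0}"

(* The infimum is taken in ereal, where it needs no boundedness or nonemptiness condition. *)
definition ground_state ::
  "real \<Rightarrow> real \<Rightarrow> (int ^ 'n \<Rightarrow> real) \<Rightarrow> (real \<Rightarrow> real) \<Rightarrow> (int ^ 'n \<Rightarrow> real) \<Rightarrow> bool" where
  "ground_state p \<alpha> h f u \<longleftrightarrow>
     u \<in> H_space p h - {\<lambda>_. 0} \<and>
     (\<forall>\<phi>\<in>H_space p h. energy_deriv p \<alpha> h f u \<phi> = 0) \<and>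
     ereal (energy p \<alpha> h f u) = (INF v\<in>nehari p \<alpha> h f. ereal (energy p \<alpha> h f v))"

definition solves_equation ::
  "real \<Rightarrow> real \<Rightarrow> (int ^ 'n \<Rightarrow> real) \<Rightarrow> (real \<Rightarrow> real) \<Rightarrow> (int ^ 'n \<Rightarrow> real) \<Rightarrow> bool" where
  "solves_equation p \<alpha> h f u \<longleftrightarrow>
     (\<forall>x. - p_laplacian p u x + h x * \<bar>u x\<bar> powr (p - 2) * u x
          = green_conv \<alpha> (\<lambda>y. primitive f (u y)) x * f (u x))"

end

(* On Z^N every l^p function is bounded, so F(u) lies in l^1 as soon as f(t) = o(|t|^(p-1)) near 0,
   and the Green's function is bounded and symmetric.  The nonlocal term is therefore a bounded
   symmetric bilinear form on l^1 evaluated at F(u), and all limits reduce to one criterion: pointwise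
   convergence with tight domination gives convergence in l^1.

   Put psi u t = t^(-p) <Phi'(tu), u> for the nonlocal part Phi of the energy.  It is strictly
   increasing by (6) and tends to 0 at 0, hence is positive.  So every ray meets the Nehari manifold,
   where t psi u t = ||u||^p, the energy is maximal there along the ray, and Phi is superquadratic:
   (p + 1) Phi(u) <= <Phi'(u), u>.  The energy then bounds the norm on the manifold; since h tends to
   infinity, a minimizing sequence converges in every sense Phi needs, and rescaling the limit gives a
   minimizer w.

   Phi is only C^1, so w is shown to be critical without Lagrange multipliers: for small s > 0 some
   point t (w + s phi) with t near 1 lies on the manifold, and J(t (w + s phi)) >= J(w) >= J(t w).
   Dividing by s t, with convexity for the norm part and the mean value theorem for Phi, gives
   <J'(w), phi> >= 0 in the limit, for phi and for -phi. *)

theory Submission imports Defs "HOL-Complex_Analysis.Great_Picard" begin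

subsection \<open>Convergence of absolutely convergent sums\<close>

text \<open>The quotient in (6) carries t^p, whereas <Phi'(tu), u> has to match t^(p-1) ||u||^p;
  hence the equation t psi u t = ||u||^p on a ray has a spare factor t. Its left side is at most t
  psi u b for t <= b and at least t psi u 1 for t >= 1, which brackets a root from both sides. The
  spare factor is also the source of p + 1: integrating s^p psi u s <= s^p psi u 1 over [0, 1] gives
  1/(p + 1), and 1/p - 1/(p + 1) = 1/(p (p + 1)) is the constant by which the energy controls the
  norm on the manifold. The obstacle to minimizing is that the norm part is only lower
  semicontinuous. On the manifold it equals <Phi'(v), v>, which does converge. So the limit w
  satisfies ||w||^p <= <Phi'(w), w>, and the infimum is the energy of w with ||w||^p replaced by
  <Phi'(w), w>. The ray inequality is therefore proved for this modified energy.\<close>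

definition l1_lim :: "(nat \<Rightarrow> 'i \<Rightarrow> real) \<Rightarrow> ('i \<Rightarrow> real) \<Rightarrow> bool" where
  "l1_lim a b \<longleftrightarrow> (\<forall>n. a n summable_on UNIV) \<and> b summable_on UNIV \<and>
     (\<lambda>n. \<Sum>\<^sub>\<infinity>x. \<bar>a n x - b x\<bar>) \<longlonglongrightarrow> 0"

text \<open>Uniformly small tails. Finite sums are used because an \<open>infsum\<close> over a
  divergent family is 0, so a bound on infinite tails would say nothing before summability is
  known.\<close>

definition tight :: "(nat \<Rightarrow> 'i \<Rightarrow> real) \<Rightarrow> bool" where
  "tight c \<longleftrightarrow> (\<forall>e>0. \<exists>K. finite K \<and> (\<forall>n A. finite A \<longrightarrow> A \<inter> K = {} \<longrightarrow> sum (c n) A \<le> e))"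

lemma summable_real_abs: "f summable_on A \<Longrightarrow> (\<lambda>x. \<bar>f x :: real\<bar>) summable_on A"
  using summable_on_iff_abs_summable_on_real by fastforce

lemma summable_real_absD: "(\<lambda>x. \<bar>f x :: real\<bar>) summable_on A \<Longrightarrow> f summable_on A"
  using summable_on_iff_abs_summable_on_real[of f A] by simp

lemma summable_real_bound:
  fixes f g :: "'i \<Rightarrow> real"
  assumes "g summable_on A" "\<And>x. x \<in> A \<Longrightarrow> \<bar>f x\<bar> \<le> g x"
  shows "f summable_on A"
proof (rule summable_real_absD, rule summable_on_comparison_test[OF assms(1)])
qed (use assms(2) in auto)

lemma abs_infsum_le_real:
  fixes f :: "'i \<Rightarrow> real"
  assumes "f summable_on A"
  shows "\<bar>infsum f A\<bar> \<le> (\<Sum>\<^sub>\<infinity>x\<in>A. \<bar>f x\<bar>)"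
  using norm_infsum_bound[of f A] summable_real_abs[OF assms] by simp

lemma infsum_diff_real:
  fixes f g :: "'i \<Rightarrow> real"
  assumes "f summable_on A" "g summable_on A"
  shows "(\<Sum>\<^sub>\<infinity>x\<in>A. f x - g x) = infsum f A - infsum g A"
  using infsum_add[OF assms(1) summable_on_uminus[THEN iffD2, OF assms(2)]] by (simp add: infsum_uminus)

lemma summable_on_diff_real:
  fixes f g :: "'i \<Rightarrow> real"
  assumes "f summable_on A" "g summable_on A"
  shows "(\<lambda>x. f x - g x) summable_on A"
  using summable_on_add[OF assms(1) summable_on_uminus[THEN iffD2, OF assms(2)]] by simp

lemma tight_const:
  assumes s: "c summable_on UNIV" and nonneg: "\<And>x. c x \<ge> (0::real)"
  shows "tight (\<lambda>n. c)"
  unfolding tight_def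
proof (intro allI impI)
  fix e :: real assume e: "e > 0"
  obtain K where K: "finite K" "dist (sum c K) (infsum c UNIV) \<le> e"
    using infsum_finite_approximation[OF s e] by blast
  show "\<exists>K. finite K \<and> (\<forall>n A. finite A \<longrightarrow> A \<inter> K = {} \<longrightarrow> sum c A \<le> e)"
  proof (intro exI conjI allI impI)
    show "finite K" by fact
    fix A :: "'a set" assume A: "finite A" "A \<inter> K = {}"
    have "sum c A + sum c K = sum c (A \<union> K)"
      using A K by (simp add: sum.union_disjoint)
    also have "\<dots> \<le> infsum c UNIV"
      using A K s nonneg by (intro finite_sum_le_infsum) auto
    finally show "sum c A \<le> e" using K(2) by (simp add: dist_real_def abs_le_iff)
  qed
qed

lemma tight_add:
  assumes "tight a" "tight b" shows "tight (\<lambda>n x. a n x + b n x)"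
  unfolding tight_def
proof (intro allI impI)
  fix e :: real assume e: "e > 0"
  obtain K where K: "finite K" "\<And>n A. finite A \<Longrightarrow> A \<inter> K = {} \<Longrightarrow> sum (a n) A \<le> e/2"
    using assms(1) e unfolding tight_def by (metis half_gt_zero)
  obtain L where L: "finite L" "\<And>n A. finite A \<Longrightarrow> A \<inter> L = {} \<Longrightarrow> sum (b n) A \<le> e/2"
    using assms(2) e unfolding tight_def by (metis half_gt_zero)
  show "\<exists>K. finite K \<and> (\<forall>n A. finite A \<longrightarrow> A \<inter> K = {} \<longrightarrow> (\<Sum>x\<in>A. a n x + b n x) \<le> e)"
  proof (intro exI[of _ "K \<union> L"] conjI allI impI)
    show "finite (K \<union> L)" using K L by auto
    fix n A assume A: "finite (A::'a set)" "A \<inter> (K \<union> L) = {}"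
    then have "sum (a n) A \<le> e/2" "sum (b n) A \<le> e/2" using K(2) L(2) by blast+
    then show "(\<Sum>x\<in>A. a n x + b n x) \<le> e" by (simp add: sum.distrib)
  qed
qed

lemma tight_mono:
  assumes "tight a" "\<And>n x. b n x \<le> C * a n x" "C \<ge> 0"
  shows "tight b"
  unfolding tight_def
proof (intro allI impI)
  fix e :: real assume e: "e > 0"
  have e': "e / (C+1) > 0" using e assms(3) by simp
  obtain K where K: "finite K" "\<And>n A. finite A \<Longrightarrow> A \<inter> K = {} \<Longrightarrow> sum (a n) A \<le> e/(C+1)"
    using assms(1) e' unfolding tight_def by metis
  show "\<exists>K. finite K \<and> (\<forall>n A. finite A \<longrightarrow> A \<inter> K = {} \<longrightarrow> sum (b n) A \<le> e)"
  proof (intro exI conjI allI impI)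
    show "finite K" by fact
    fix n A assume A: "finite (A::'a set)" "A \<inter> K = {}"
    have "sum (b n) A \<le> C * sum (a n) A"
      unfolding sum_distrib_left by (intro sum_mono assms)
    also have "\<dots> \<le> C * (e/(C+1))" using K(2)[OF A] assms(3) by (intro mult_left_mono) auto
    also have "\<dots> \<le> e" using e assms(3) by (simp add: divide_simps)
    finally show "sum (b n) A \<le> e" .
  qed
qed

text \<open>The dominating family may vary with n, so this is a Vitali-type theorem rather than
  dominated convergence. Outside a finite set K, all \<open>a n\<close> and, by passing to the limit
  in finite sums, also \<open>b\<close> are small; on K pointwise convergence suffices. Summability
  of \<open>a n\<close> and \<open>b\<close> comes out of the same estimate with tolerance
  1.\<close>

lemma l1_lim_tight:
  assumes pw: "\<And>x. (\<lambda>n. a n x) \<longlonglongrightarrow> b x"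
    and bound: "\<And>n x. \<bar>a n x\<bar> \<le> c n x" and t: "tight c"
  shows "l1_lim a b"
proof -
  have key: "\<exists>K. finite K \<and> (\<forall>n A. finite A \<longrightarrow> (\<Sum>x\<in>A. \<bar>a n x - b x\<bar>) \<le> (\<Sum>x\<in>K. \<bar>a n x - b x\<bar>) + e) \<and>
       (\<forall>A. finite A \<longrightarrow> A \<inter> K = {} \<longrightarrow> (\<Sum>x\<in>A. \<bar>b x\<bar>) \<le> e)" if e: "e > 0" for e
  proof -
    obtain K where K: "finite K" "\<And>n A. finite A \<Longrightarrow> A \<inter> K = {} \<Longrightarrow> sum (c n) A \<le> e/2"
      using t e unfolding tight_def by (metis half_gt_zero)
    have an: "(\<Sum>x\<in>A. \<bar>a n x\<bar>) \<le> e/2" if "finite A" "A \<inter> K = {}" for n A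
      by (rule order_trans[OF sum_mono K(2)[OF that]]) (rule bound)
    have bn: "(\<Sum>x\<in>A. \<bar>b x\<bar>) \<le> e/2" if A: "finite A" "A \<inter> K = {}" for A
    proof (rule tendsto_upperbound)
      show "(\<lambda>n. \<Sum>x\<in>A. \<bar>a n x\<bar>) \<longlonglongrightarrow> (\<Sum>x\<in>A. \<bar>b x\<bar>)"
        by (intro tendsto_intros pw)
    qed (use an[OF A] in auto)
    show ?thesis
    proof (intro exI[of _ K] conjI allI impI)
      show "finite K" by fact
    next
      fix n A assume A: "finite (A :: 'a set)"
      have "(\<Sum>x\<in>A. \<bar>a n x - b x\<bar>) \<le> (\<Sum>x\<in>K \<union> (A - K). \<bar>a n x - b x\<bar>)"
        using A K by (intro sum_mono2) auto
      also have "\<dots> = (\<Sum>x\<in>K. \<bar>a n x - b x\<bar>) + (\<Sum>x\<in>A-K. \<bar>a n x - b x\<bar>)"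
        using A K by (intro sum.union_disjoint) auto
      also have "(\<Sum>x\<in>A-K. \<bar>a n x - b x\<bar>) \<le> (\<Sum>x\<in>A-K. \<bar>a n x\<bar> + \<bar>b x\<bar>)"
        by (intro sum_mono) auto
      also have "\<dots> \<le> e"
        using an[of "A-K" n] bn[of "A-K"] A by (simp add: sum.distrib Diff_Int_distrib2)
      finally show "(\<Sum>x\<in>A. \<bar>a n x - b x\<bar>) \<le> (\<Sum>x\<in>K. \<bar>a n x - b x\<bar>) + e" by simp
    next
      fix A assume "finite (A :: 'a set)" "A \<inter> K = {}"
      then show "(\<Sum>x\<in>A. \<bar>b x\<bar>) \<le> e" using bn e by fastforce
    qed
  qed
  obtain K where K: "finite K" "\<And>n A. finite A \<Longrightarrow> (\<Sum>x\<in>A. \<bar>a n x - b x\<bar>) \<le> (\<Sum>x\<in>K. \<bar>a n x - b x\<bar>) + 1"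
       "\<And>A. finite A \<Longrightarrow> A \<inter> K = {} \<Longrightarrow> (\<Sum>x\<in>A. \<bar>b x\<bar>) \<le> 1"
    using key[of 1] by auto
  have ds: "(\<lambda>x. \<bar>a n x - b x\<bar>) summable_on UNIV" for n
    by (rule nonneg_bdd_above_summable_on) (use K(2) in \<open>auto intro!: bdd_aboveI\<close>)
  have "(\<Sum>x\<in>A. \<bar>b x\<bar>) \<le> (\<Sum>x\<in>K. \<bar>b x\<bar>) + 1" if A: "finite A" for A
  proof -
    have "(\<Sum>x\<in>A. \<bar>b x\<bar>) \<le> (\<Sum>x\<in>K \<union> (A - K). \<bar>b x\<bar>)"
      using A K by (intro sum_mono2) auto
    also have "\<dots> = (\<Sum>x\<in>K. \<bar>b x\<bar>) + (\<Sum>x\<in>A-K. \<bar>b x\<bar>)"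
      using A K by (intro sum.union_disjoint) auto
    finally show ?thesis using K(3)[of "A-K"] A by fastforce
  qed
  then have "(\<lambda>x. \<bar>b x\<bar>) summable_on UNIV"
    by (intro nonneg_bdd_above_summable_on) (auto intro!: bdd_aboveI)
  then have bs: "b summable_on UNIV" by (rule summable_real_absD)
  have as: "a n summable_on UNIV" for n
    using summable_on_add[OF summable_real_absD[OF ds[of n]] bs] by simp
  have "(\<lambda>n. \<Sum>\<^sub>\<infinity>x. \<bar>a n x - b x\<bar>) \<longlonglongrightarrow> 0"
  proof (rule LIMSEQ_I)
    fix r :: real assume r: "r > 0"
    obtain L where L: "finite L" "\<And>n A. finite A \<Longrightarrow> (\<Sum>x\<in>A. \<bar>a n x - b x\<bar>) \<le> (\<Sum>x\<in>L. \<bar>a n x - b x\<bar>) + r/2"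
      using key[of "r/2"] r by auto
    have le: "(\<Sum>\<^sub>\<infinity>x. \<bar>a n x - b x\<bar>) \<le> (\<Sum>x\<in>L. \<bar>a n x - b x\<bar>) + r/2" for n
      by (rule infsum_le_finite_sums[OF ds]) (use L in auto)
    have "(\<lambda>n. \<Sum>x\<in>L. \<bar>a n x - b x\<bar>) \<longlonglongrightarrow> (\<Sum>x\<in>L. \<bar>b x - b x\<bar>)"
      by (intro tendsto_intros pw)
    then have "eventually (\<lambda>n. (\<Sum>x\<in>L. \<bar>a n x - b x\<bar>) < r/2) sequentially"
      using r by (intro order_tendstoD) auto
    then obtain n0 where n0: "\<And>n. n \<ge> n0 \<Longrightarrow> (\<Sum>x\<in>L. \<bar>a n x - b x\<bar>) < r/2"
      unfolding eventually_sequentially by auto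
    show "\<exists>no. \<forall>n\<ge>no. norm ((\<Sum>\<^sub>\<infinity>x. \<bar>a n x - b x\<bar>) - 0) < r"
    proof (intro exI[of _ n0] allI impI)
      fix n assume "n \<ge> n0"
      moreover have "(\<Sum>\<^sub>\<infinity>x. \<bar>a n x - b x\<bar>) \<ge> 0" by (intro infsum_nonneg) auto
      ultimately show "norm ((\<Sum>\<^sub>\<infinity>x. \<bar>a n x - b x\<bar>) - 0) < r"
        using le[of n] n0[of n] by simp
    qed
  qed
  then show ?thesis unfolding l1_lim_def using as bs by blast
qed

lemma l1_lim_infsum:
  assumes "l1_lim a b" shows "(\<lambda>n. infsum (a n) UNIV) \<longlonglongrightarrow> infsum b UNIV"
proof -
  have s: "\<And>n. a n summable_on UNIV" "b summable_on UNIV"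
    and l: "(\<lambda>n. \<Sum>\<^sub>\<infinity>x. \<bar>a n x - b x\<bar>) \<longlonglongrightarrow> 0" using assms unfolding l1_lim_def by auto
  have "(\<lambda>n. infsum (a n) UNIV - infsum b UNIV) \<longlonglongrightarrow> 0"
  proof (rule tendsto_rabs_zero_cancel, rule tendsto_sandwich[OF _ _ tendsto_const l])
    show "eventually (\<lambda>n. \<bar>infsum (a n) UNIV - infsum b UNIV\<bar> \<le> (\<Sum>\<^sub>\<infinity>x. \<bar>a n x - b x\<bar>)) sequentially"
      using abs_infsum_le_real[OF summable_on_diff_real[OF s(1) s(2)]]
      by (simp add: infsum_diff_real[OF s(1) s(2)])
  qed simp
  then show ?thesis by (simp add: LIM_zero_iff)
qed

lemma l1_lim_const: "b summable_on UNIV \<Longrightarrow> l1_lim (\<lambda>n. b) b"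
  unfolding l1_lim_def by simp

subsection \<open>Bounded symmetric kernels\<close>

definition kernel_form :: "('i \<Rightarrow> 'i \<Rightarrow> real) \<Rightarrow> ('i \<Rightarrow> real) \<Rightarrow> ('i \<Rightarrow> real) \<Rightarrow> real" where
  "kernel_form R a b = (\<Sum>\<^sub>\<infinity>x. (\<Sum>\<^sub>\<infinity>y. R x y * a y) * b x)"

locale bounded_kernel =
  fixes R :: "'i \<Rightarrow> 'i \<Rightarrow> real" and B :: real
  assumes R_bound: "\<bar>R x y\<bar> \<le> B" and R_sym: "R x y = R y x"
begin

lemma B_nonneg: "B \<ge> 0"
  using R_bound[of undefined undefined] by linarith

lemma row_summable: "a summable_on UNIV \<Longrightarrow> (\<lambda>y. R x y * a y) summable_on UNIV"
  by (rule summable_real_bound[OF summable_on_cmult_right[OF summable_real_abs, of a UNIV B]])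
     (auto simp: abs_mult intro!: mult_right_mono R_bound)

lemma row_bound:
  assumes "a summable_on UNIV"
  shows "\<bar>\<Sum>\<^sub>\<infinity>y. R x y * a y\<bar> \<le> B * (\<Sum>\<^sub>\<infinity>y. \<bar>a y\<bar>)"
proof -
  have "\<bar>\<Sum>\<^sub>\<infinity>y. R x y * a y\<bar> \<le> (\<Sum>\<^sub>\<infinity>y. \<bar>R x y * a y\<bar>)"
    by (rule abs_infsum_le_real[OF row_summable[OF assms]])
  also have "\<dots> \<le> (\<Sum>\<^sub>\<infinity>y. B * \<bar>a y\<bar>)"
    using assms by (intro infsum_mono summable_real_abs row_summable summable_on_cmult_right)
      (auto simp: abs_mult intro!: mult_right_mono R_bound)
  finally show ?thesis using infsum_cmult_right[of B "\<lambda>y. \<bar>a y\<bar>" UNIV] summable_real_abs[OF assms]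
    by simp
qed

lemma form_summable:
  assumes "a summable_on UNIV" "b summable_on UNIV"
  shows "(\<lambda>x. (\<Sum>\<^sub>\<infinity>y. R x y * a y) * b x) summable_on UNIV"
  by (rule summable_real_bound[OF summable_on_cmult_right[OF summable_real_abs[OF assms(2)],
        of "B * (\<Sum>\<^sub>\<infinity>y. \<bar>a y\<bar>)"]])
     (auto simp: abs_mult intro!: mult_right_mono row_bound assms)

lemma form_bound:
  assumes "a summable_on UNIV" "b summable_on UNIV"
  shows "\<bar>kernel_form R a b\<bar> \<le> B * (\<Sum>\<^sub>\<infinity>y. \<bar>a y\<bar>) * (\<Sum>\<^sub>\<infinity>y. \<bar>b y\<bar>)"
proof -
  have "\<bar>kernel_form R a b\<bar> \<le> (\<Sum>\<^sub>\<infinity>x. \<bar>(\<Sum>\<^sub>\<infinity>y. R x y * a y) * b x\<bar>)"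
    unfolding kernel_form_def by (rule abs_infsum_le_real[OF form_summable[OF assms]])
  also have "\<dots> \<le> (\<Sum>\<^sub>\<infinity>x. (B * (\<Sum>\<^sub>\<infinity>y. \<bar>a y\<bar>)) * \<bar>b x\<bar>)"
    using assms by (intro infsum_mono summable_real_abs form_summable summable_on_cmult_right)
      (auto simp: abs_mult intro!: mult_right_mono row_bound)
  finally show ?thesis
    using infsum_cmult_right[of "B * (\<Sum>\<^sub>\<infinity>y. \<bar>a y\<bar>)" "\<lambda>y. \<bar>b y\<bar>" UNIV] summable_real_abs[OF assms(2)]
    by simp
qed

lemma form_diff_left:
  assumes "a summable_on UNIV" "a' summable_on UNIV" "b summable_on UNIV"
  shows "kernel_form R (\<lambda>x. a x - a' x) b = kernel_form R a b - kernel_form R a' b"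
  unfolding kernel_form_def
  by (simp add: right_diff_distrib left_diff_distrib infsum_diff_real row_summable form_summable assms)

lemma form_diff_right:
  assumes "a summable_on UNIV" "b summable_on UNIV" "b' summable_on UNIV"
  shows "kernel_form R a (\<lambda>x. b x - b' x) = kernel_form R a b - kernel_form R a b'"
  unfolding kernel_form_def
  by (simp add: right_diff_distrib infsum_diff_real form_summable assms)

lemma form_scale_left:
  "kernel_form R (\<lambda>x. c * a x) b = c * kernel_form R a b"
  unfolding kernel_form_def
  by (simp add: mult.left_commute[of _ c] mult.assoc infsum_cmult_right')

lemma form_scale_right:
  "kernel_form R a (\<lambda>x. c * b x) = c * kernel_form R a b"
  unfolding kernel_form_def
  by (simp add: mult.left_commute[of _ c] infsum_cmult_right')

text \<open>Fubini for the double sum: it converges absolutely because B |b x| |a y| is a product of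
  two summable families.\<close>

lemma form_sym:
  assumes a: "a summable_on UNIV" and b: "b summable_on UNIV"
  shows "kernel_form R a b = kernel_form R b a"
proof -
  have s: "(\<lambda>(x, y). R x y * a y * b x) summable_on UNIV \<times> UNIV"
  proof (rule summable_real_bound)
    have "(\<lambda>(x, y). \<bar>b x\<bar> * \<bar>a y\<bar>) summable_on UNIV \<times> UNIV"
      by (rule summable_on_SigmaI[where g = "\<lambda>x. \<bar>b x\<bar> * (\<Sum>\<^sub>\<infinity>y. \<bar>a y\<bar>)"])
         (auto intro!: has_sum_cmult_right has_sum_infsum summable_on_cmult_left summable_real_abs a b)
    then show "(\<lambda>(x, y). B * (\<bar>b x\<bar> * \<bar>a y\<bar>)) summable_on UNIV \<times> UNIV"
      using summable_on_cmult_right[of "\<lambda>(x, y). \<bar>b x\<bar> * \<bar>a y\<bar>" "UNIV \<times> UNIV" B]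
      by (simp add: case_prod_unfold)
  qed (auto simp: abs_mult mult.commute[of "\<bar>b _\<bar>"] simp flip: mult.assoc
        intro!: mult_right_mono R_bound)
  have "kernel_form R a b = (\<Sum>\<^sub>\<infinity>x. \<Sum>\<^sub>\<infinity>y. R x y * a y * b x)"
    unfolding kernel_form_def by (intro infsum_cong infsum_cmult_left[symmetric] row_summable a)
  also have "\<dots> = (\<Sum>\<^sub>\<infinity>y. \<Sum>\<^sub>\<infinity>x. R x y * a y * b x)"
    by (rule infsum_swap_banach) (use s in auto)
  also have "\<dots> = (\<Sum>\<^sub>\<infinity>y. \<Sum>\<^sub>\<infinity>x. (R y x * b x) * a y)"
    by (simp add: R_sym[of _ y for y] mult.commute mult.left_commute)
  also have "\<dots> = kernel_form R b a"
    unfolding kernel_form_def by (intro infsum_cong infsum_cmult_left row_summable b)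
  finally show ?thesis .
qed

lemma form_tendsto:
  assumes a: "l1_lim a a'" and b: "l1_lim b b'"
  shows "(\<lambda>n. kernel_form R (a n) (b n)) \<longlonglongrightarrow> kernel_form R a' b'"
proof -
  have sa: "a n summable_on UNIV" "a' summable_on UNIV" "(\<lambda>x. a n x - a' x) summable_on UNIV" 
   and sb: "b n summable_on UNIV" "b' summable_on UNIV" "(\<lambda>x. b n x - b' x) summable_on UNIV"
   and la: "(\<lambda>n. \<Sum>\<^sub>\<infinity>x. \<bar>a n x - a' x\<bar>) \<longlonglongrightarrow> 0" and lb: "(\<lambda>n. \<Sum>\<^sub>\<infinity>x. \<bar>b n x - b' x\<bar>) \<longlonglongrightarrow> 0" for n
    using a b unfolding l1_lim_def by (auto intro: summable_on_diff_real)
  let ?A = "\<lambda>n. \<Sum>\<^sub>\<infinity>x. \<bar>a n x - a' x\<bar>" and ?B = "\<lambda>n. \<Sum>\<^sub>\<infinity>x. \<bar>b n x - b' x\<bar>"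
  let ?g = "\<lambda>n. B * ?A n * ?B n + B * ?A n * (\<Sum>\<^sub>\<infinity>x. \<bar>b' x\<bar>) + B * (\<Sum>\<^sub>\<infinity>x. \<bar>a' x\<bar>) * ?B n"
  have bd: "\<bar>kernel_form R (a n) (b n) - kernel_form R a' b'\<bar> \<le> ?g n" for n
  proof -
    \<comment> \<open>Expanding around the limits leaves only norms of differences and of the fixed
      limits, so no bound on the norms of \<open>a n\<close> and \<open>b n\<close> has to be
      provided.\<close>
    have "kernel_form R (a n) (b n) - kernel_form R a' b' =
      kernel_form R (\<lambda>x. a n x - a' x) (\<lambda>x. b n x - b' x) +
      kernel_form R (\<lambda>x. a n x - a' x) b' + kernel_form R a' (\<lambda>x. b n x - b' x)"
      by (simp add: form_diff_left form_diff_right sa sb)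
    then show ?thesis
      using form_bound[OF sa(3)[of n] sb(3)[of n]] form_bound[OF sa(3)[of n] sb(2)]
        form_bound[OF sa(2) sb(3)[of n]] by linarith
  qed
  have "?g \<longlonglongrightarrow> B * 0 * 0 + B * 0 * (\<Sum>\<^sub>\<infinity>x. \<bar>b' x\<bar>) + B * (\<Sum>\<^sub>\<infinity>x. \<bar>a' x\<bar>) * 0"
    by (intro tendsto_intros la lb)
  then have g0: "?g \<longlonglongrightarrow> 0" by simp
  have "(\<lambda>n. kernel_form R (a n) (b n) - kernel_form R a' b') \<longlonglongrightarrow> 0"
    by (rule tendsto_rabs_zero_cancel, rule tendsto_sandwich[OF _ _ tendsto_const g0])
       (use bd in auto)
  then show ?thesis by (simp add: LIM_zero_iff)
qed

end

subsection \<open>The Green's function\<close>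

text \<open>The phase factor has modulus 1, so one integral bounds the kernel for all x and
  y.\<close>

lemma green_bounded: "\<exists>B. \<forall>x y. \<bar>green \<alpha> x (y :: int ^ 'n)\<bar> \<le> B"
proof -
  let ?I = "\<lambda>x y. LINT k:(period_cube :: (real ^ 'n) set)|lborel.
           exp (\<i> * complex_of_real (\<Sum>j\<in>UNIV. real_of_int (x $ j - y $ j) * k $ j)) *
           complex_of_real (lap_symbol k powr (- \<alpha> / 2))"
  let ?M = "LINT k:(period_cube :: (real ^ 'n) set)|lborel. lap_symbol k powr (- \<alpha> / 2)"
  \<comment> \<open>\<open>integral_norm_bound\<close> also covers a non-integrable integrand, whose
    integral is 0 by convention.\<close>
  have "norm (?I x y) \<le> ?M" for x y
    unfolding set_lebesgue_integral_def
    by (rule order_trans[OF integral_norm_bound]) (simp add: norm_mult)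
  then have "\<bar>Re (?I x y)\<bar> \<le> ?M" for x y
    using abs_Re_le_cmod order_trans by blast
  then have "\<bar>green \<alpha> x y\<bar> \<le> \<bar>K_const TYPE('n) \<alpha> / (2 * pi) ^ CARD('n)\<bar> * ?M" for x y :: "int ^ 'n"
    unfolding green_def abs_mult by (intro mult_left_mono) auto
  then show ?thesis by blast
qed

text \<open>Exchanging x and y conjugates the integrand, and the real part ignores
  conjugation.\<close>

lemma green_sym: "green \<alpha> x y = green \<alpha> y (x :: int ^ 'n)"
proof -
  let ?f = "\<lambda>x y k. indicator (period_cube :: (real ^ 'n) set) k *\<^sub>R
           (exp (\<i> * complex_of_real (\<Sum>j\<in>UNIV. real_of_int (x $ j - y $ j) * k $ j)) *
           complex_of_real (lap_symbol k powr (- \<alpha> / 2)))"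
  have "(\<Sum>j\<in>UNIV. real_of_int (y $ j - x $ j) * k $ j) = - (\<Sum>j\<in>UNIV. real_of_int (x $ j - y $ j) * k $ j)"
    for k :: "real ^ 'n"
    unfolding sum_negf[symmetric] by (intro sum.cong) (simp_all add: algebra_simps)
  then have "cnj (?f x y k) = ?f y x k" for k
    by (simp only: of_real_minus) (simp add: exp_cnj del: of_real_sum)
  then have "(LINT k|lborel. ?f y x k) = (LINT k|lborel. cnj (?f x y k))" by presburger
  also have "\<dots> = cnj (LINT k|lborel. ?f x y k)" by (rule Bochner_Integration.integral_cnj)
  finally have "Re (LINT k|lborel. ?f y x k) = Re (LINT k|lborel. ?f x y k)" by simp
  then show ?thesis unfolding green_def set_lebesgue_integral_def by simp
qed

subsection \<open>The lattice graph\<close>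

lemma lattice_adj_sym: "lattice_adj x y \<longleftrightarrow> lattice_adj y x"
  unfolding lattice_adj_def by (simp add: abs_minus_commute)

lemma lattice_adj_add: "lattice_adj x (x + e) \<longleftrightarrow> lattice_adj 0 e"
  unfolding lattice_adj_def by (simp add: abs_minus_commute)

lemma finite_unit_steps: "finite {e :: int ^ 'n. lattice_adj 0 e}"
proof (rule finite_subset)
  show "{e :: int ^ 'n. lattice_adj 0 e} \<subseteq> vec_lambda ` (UNIV \<rightarrow>\<^sub>E {-1..1})"
  proof
    fix e :: "int ^ 'n" assume "e \<in> {e. lattice_adj 0 e}"
    then have s: "(\<Sum>i\<in>UNIV. \<bar>e $ i\<bar>) = 1" unfolding lattice_adj_def by simp
    have "e $ i \<in> {-1..1}" for i
    proof -
      have "\<bar>e $ i\<bar> \<le> 1" using member_le_sum[of i UNIV "\<lambda>i. \<bar>e $ i\<bar>"] s by simp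
      then show ?thesis by (simp, arith)
    qed
    then have "($) e \<in> UNIV \<rightarrow>\<^sub>E {-1..1}" by (simp add: PiE_UNIV_domain)
    then show "e \<in> vec_lambda ` (UNIV \<rightarrow>\<^sub>E {-1..1})"
      by (rule image_eqI[rotated]) simp
  qed
qed (intro finite_imageI finite_PiE; simp)

lemma neighbours_eq: "{y. lattice_adj x y} = (\<lambda>e. x + e) ` {e. lattice_adj 0 e}"
proof (intro set_eqI iffI)
  fix y assume "y \<in> {y. lattice_adj x y}"
  then show "y \<in> (\<lambda>e. x + e) ` {e. lattice_adj 0 e}"
    using lattice_adj_add[of x "y - x"] by (intro image_eqI[of _ _ "y - x"]) simp_all
qed (auto simp: lattice_adj_add)

lemma finite_neighbours: "finite {y :: int ^ 'n. lattice_adj x y}"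
  by (subst neighbours_eq) (intro finite_imageI finite_unit_steps)

lemma sum_neighbours:
  "(\<Sum>y | lattice_adj x y. g y) = (\<Sum>e | lattice_adj 0 e. g (x + e))"
  by (subst neighbours_eq, subst sum.reindex) auto

text \<open>Guarantees that the \<open>LEAST\<close> in \<open>lattice_dist\<close> is attained by a
  path. Induction on the l^1 distance: one unit step towards y in a coordinate where x and y differ
  lowers it by 1.\<close>

lemma lattice_connected: "\<exists>n. (lattice_adj ^^ n) x (y :: int ^ 'n)"
proof (induction "nat (\<Sum>i\<in>UNIV. \<bar>x $ i - y $ i\<bar>)" arbitrary: x)
  case 0
  then have "(\<Sum>i\<in>UNIV. \<bar>x $ i - y $ i\<bar>) = 0"
    by (intro antisym) (auto intro: sum_nonneg)
  then have "x = y" by (simp add: sum_nonneg_eq_0_iff vec_eq_iff)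
  then show ?case by (intro exI[of _ 0]) simp
next
  case (Suc m)
  obtain i where i: "x $ i \<noteq> y $ i"
    using Suc(2) by (metis (mono_tags, lifting) abs_zero nat_0 nat.distinct(1) right_minus_eq sum.neutral)
  define x' where "x' = (\<chi> j. if j = i then x $ i - sgn (x $ i - y $ i) else x $ j)"
  have adj: "lattice_adj x x'"
  proof -
    have "(\<Sum>j\<in>UNIV. \<bar>x $ j - x' $ j\<bar>) = (\<Sum>j\<in>UNIV. if j = i then 1 else 0)"
      unfolding x'_def using i by (intro sum.cong) (auto simp: abs_sgn_eq)
    then show ?thesis unfolding lattice_adj_def by simp
  qed
  have "(\<Sum>j\<in>UNIV. \<bar>x $ j - y $ j\<bar>) = (\<Sum>j\<in>UNIV. \<bar>x' $ j - y $ j\<bar> + (if j = i then 1 else 0))"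
    unfolding x'_def using i by (intro sum.cong) (auto simp: sgn_if)
  then have "m = nat (\<Sum>j\<in>UNIV. \<bar>x' $ j - y $ j\<bar>)"
    using Suc(2) by (simp add: sum.distrib)
  from Suc(1)[OF this] obtain n where "(lattice_adj ^^ n) x' y" by blast
  then have "(lattice_adj ^^ Suc n) x y" using adj by (metis relpowp_Suc_I2)
  then show ?case by blast
qed

lemma finite_lattice_ball: "finite {x :: int ^ 'n. lattice_dist x y < n}"
proof -
  have fin: "finite {x :: int ^ 'n. (lattice_adj ^^ m) x y}" for m
  proof (induction m)
    case (Suc m)
    have "{x. (lattice_adj ^^ Suc m) x y} \<subseteq> (\<Union>z\<in>{z. (lattice_adj ^^ m) z y}. {x. lattice_adj z x})"
      using lattice_adj_sym by (fastforce dest: relpowp_Suc_D2)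
    then show ?case using Suc finite_neighbours by (metis (no_types, lifting) finite_UN finite_subset)
  qed simp
  have "{x. lattice_dist x y < n} \<subseteq> (\<Union>m<n. {x. (lattice_adj ^^ m) x y})"
    using LeastI_ex[OF lattice_connected] unfolding lattice_dist_def by fastforce
  then show ?thesis using fin by (meson finite_UN finite_lessThan finite_subset)
qed

text \<open>This is the form in which condition (2) enters the compactness argument. Balls are
  finite because every vertex has finitely many neighbours.\<close>

lemma coercive_finite_sublevel:
  assumes "filterlim h at_top (filtercomap (\<lambda>x. lattice_dist x x\<^sub>0) at_top)"
  shows "finite {x :: int ^ 'n. h x < (Z :: real)}"
proof -
  have "eventually (\<lambda>x. h x \<ge> Z) (filtercomap (\<lambda>x. lattice_dist x x\<^sub>0) at_top)"
    using assms by (simp add: filterlim_at_top)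
  then obtain n where n: "\<And>x. lattice_dist x x\<^sub>0 \<ge> n \<Longrightarrow> h x \<ge> Z"
    by (auto simp: eventually_filtercomap eventually_at_top_linorder)
  have "{x. h x < Z} \<subseteq> {x. lattice_dist x x\<^sub>0 < n}"
  proof
    fix x assume "x \<in> {x. h x < Z}"
    then have "\<not> h x \<ge> Z" by simp
    then have "\<not> lattice_dist x x\<^sub>0 \<ge> n" using n by blast
    then show "x \<in> {x. lattice_dist x x\<^sub>0 < n}" by simp
  qed
  then show ?thesis using finite_lattice_ball finite_subset by blast
qed

subsection \<open>Power inequalities\<close>

lemma powr_add_le:
  fixes a b p :: real
  assumes "a \<ge> 0" "b \<ge> 0" "p \<ge> 0"
  shows "(a + b) powr p \<le> 2 powr p * (a powr p + b powr p)"
proof -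
  have "(a + b) powr p \<le> (2 * max a b) powr p" using assms by (intro powr_mono2) auto
  also have "\<dots> = 2 powr p * (max a b) powr p" using assms by (simp add: powr_mult)
  also have "(max a b) powr p \<le> a powr p + b powr p" using assms by (simp add: max_def)
  finally show ?thesis by simp
qed

text \<open>Holds for every exponent since 0 powr q is 0 for all q. This is what makes the exponent
  p - 2 harmless at p = 2.\<close>

lemma powr_mult_self:
  fixes a p :: real
  assumes "a \<ge> 0" shows "a powr (p - 1) * a = a powr p"
  using assms powr_add[of a "p-1" 1] by (cases "a = 0") auto

text \<open>A crude Young inequality, obtained by replacing both a and b by their maximum; it serves
  where only a summable majorant is wanted.\<close>

lemma powr_mult_le:
  fixes a b p :: real
  assumes "a \<ge> 0" "b \<ge> 0" "p \<ge> 1"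
  shows "a powr (p - 1) * b \<le> a powr p + b powr p"
proof -
  have "a powr (p - 1) * b \<le> (max a b) powr (p - 1) * max a b"
    using assms by (intro mult_mono powr_mono2) auto
  also have "\<dots> = (max a b) powr p" using assms by (intro powr_mult_self) auto
  also have "\<dots> \<le> a powr p + b powr p" using assms by (simp add: max_def)
  finally show ?thesis .
qed

text \<open>The sharp constants matter here: they turn into the convexity inequality
  \<open>Nd_Young\<close>.\<close>

lemma powr_Young:
  fixes a b p :: real
  assumes "a \<ge> 0" "b \<ge> 0" "p > 1"
  shows "a powr (p - 1) * b \<le> (1 - 1/p) * a powr p + 1/p * b powr p"
proof (cases "a = 0 \<or> b = 0")
  case True
  then show ?thesis using assms by auto
next
  case False
  have "(a powr p) powr (1 - 1/p) * (b powr p) powr (1/p) \<le> (1 - 1/p) * a powr p + 1/p * b powr p"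
    using assms False by (intro Youngs_inequality_0) auto
  moreover have "p * (1 - 1/p) = p - 1" using assms by (simp add: field_simps)
  ultimately show ?thesis using assms by (simp add: powr_powr)
qed

lemma tendsto_abs_powr:
  fixes f :: "'a \<Rightarrow> real"
  assumes "(f \<longlongrightarrow> a) F" "p > 0"
  shows "((\<lambda>x. \<bar>f x\<bar> powr p) \<longlongrightarrow> \<bar>a\<bar> powr p) F"
  using assms by (intro tendsto_powr' tendsto_intros) auto

subsection \<open>The sequence space\<close>

definition in_lp :: "real \<Rightarrow> ('i \<Rightarrow> real) \<Rightarrow> bool" where
  "in_lp p u \<longleftrightarrow> (\<lambda>x. \<bar>u x\<bar> powr p) summable_on UNIV"

lemma in_lp_mono:
  assumes "in_lp p v" "\<And>x. \<bar>u x\<bar> \<le> \<bar>v x\<bar>" "p \<ge> 0"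
  shows "in_lp p u"
  unfolding in_lp_def
  by (rule summable_real_bound[OF assms(1)[unfolded in_lp_def]]) (auto intro!: powr_mono2 assms)

lemma in_lp_scale: "in_lp p u \<Longrightarrow> in_lp p (\<lambda>x. c * u x)"
  unfolding in_lp_def by (simp add: abs_mult powr_mult summable_on_cmult_right)

lemma in_lp_abs: "in_lp p u \<Longrightarrow> in_lp p (\<lambda>x. \<bar>u x\<bar>)"
  unfolding in_lp_def by simp

lemma in_lp_add:
  assumes "in_lp p u" "in_lp p v" "p \<ge> 0"
  shows "in_lp p (\<lambda>x. u x + v x)"
  unfolding in_lp_def
proof (rule summable_real_bound)
  show "(\<lambda>x. 2 powr p * (\<bar>u x\<bar> powr p + \<bar>v x\<bar> powr p)) summable_on UNIV"
    using assms unfolding in_lp_def by (intro summable_on_cmult_right summable_on_add)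
  fix x
  have "\<bar>u x + v x\<bar> powr p \<le> (\<bar>u x\<bar> + \<bar>v x\<bar>) powr p"
    using assms by (intro powr_mono2) auto
  also have "\<dots> \<le> 2 powr p * (\<bar>u x\<bar> powr p + \<bar>v x\<bar> powr p)"
    using assms by (intro powr_add_le) auto
  finally show "\<bar>\<bar>u x + v x\<bar> powr p\<bar> \<le> 2 powr p * (\<bar>u x\<bar> powr p + \<bar>v x\<bar> powr p)" by simp
qed

lemma in_lp_sum:
  assumes "finite E" "\<And>e. e \<in> E \<Longrightarrow> in_lp p (a e)" "p \<ge> 0"
  shows "in_lp p (\<lambda>x. \<Sum>e\<in>E. a e x)"
  using assms
proof (induction E rule: finite_induct)
  case empty
  then show ?case by (simp add: in_lp_def)
qed (auto intro: in_lp_add)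

lemma in_lp_finite: "finite {x. u x \<noteq> 0} \<Longrightarrow> in_lp p u"
  unfolding in_lp_def by (rule finite_nonzero_values_imp_summable_on) (auto elim: finite_subset[rotated])

lemma in_lp_translate:
  fixes u :: "'a :: ab_group_add \<Rightarrow> real"
  assumes "in_lp p u" shows "in_lp p (\<lambda>x. u (x + e))"
proof -
  have "bij (\<lambda>x. x + e)" by (intro bij_betwI[of _ _ _ "\<lambda>x. x - e"]) auto
  from summable_on_reindex_bij_betw[OF this, of "\<lambda>x. \<bar>u x\<bar> powr p"]
  show ?thesis using assms unfolding in_lp_def by simp
qed

lemma in_lp_bounded:
  assumes "in_lp p u" "p > 0"
  shows "\<exists>M>0. \<forall>x. \<bar>u x\<bar> \<le> M"
proof -
  let ?S = "\<Sum>\<^sub>\<infinity>x. \<bar>u x\<bar> powr p"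
  have "\<bar>u x\<bar> \<le> ?S powr (1/p)" for x
  proof -
    have "\<bar>u x\<bar> powr p \<le> ?S"
      using finite_sum_le_infsum[of "\<lambda>x. \<bar>u x\<bar> powr p" UNIV "{x}"] assms by (simp add: in_lp_def)
    then have "(\<bar>u x\<bar> powr p) powr (1/p) \<le> ?S powr (1/p)"
      using assms by (intro powr_mono2) auto
    then show ?thesis using assms by (simp add: powr_powr)
  qed
  then show ?thesis by (intro exI[of _ "?S powr (1/p) + 1"]) (auto intro: add_increasing2 add_nonneg_pos)
qed

subsection \<open>Gradients\<close>

lemma grad_norm_L2: "grad_norm u x = L2_set (\<lambda>y. u y - u x) {y. lattice_adj x y} / sqrt 2"
  unfolding grad_norm_def L2_set_def by (simp add: real_sqrt_divide)

lemma grad_norm_nonneg: "grad_norm u x \<ge> 0"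
  unfolding grad_norm_def by (simp add: sum_nonneg)

lemma grad_prod_self: "grad_prod u u x = (grad_norm u x)\<^sup>2"
  unfolding grad_norm_def grad_prod_def by (simp add: sum_nonneg power2_eq_square)

lemma grad_prod_CS: "\<bar>grad_prod u v x\<bar> \<le> grad_norm u x * grad_norm v x"
proof -
  let ?N = "{y. lattice_adj x y}"
  have "\<bar>\<Sum>y\<in>?N. (u y - u x) * (v y - v x)\<bar> \<le> (\<Sum>y\<in>?N. \<bar>u y - u x\<bar> * \<bar>v y - v x\<bar>)"
    by (rule order_trans[OF sum_abs]) (simp add: abs_mult)
  also have "\<dots> \<le> L2_set (\<lambda>y. u y - u x) ?N * L2_set (\<lambda>y. v y - v x) ?N"
    by (rule L2_set_mult_ineq)
  finally show ?thesis unfolding grad_norm_L2 grad_prod_def by simp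
qed

lemma grad_norm_combine:
  "grad_norm (\<lambda>x. a * u x + b * v x) x \<le> \<bar>a\<bar> * grad_norm u x + \<bar>b\<bar> * grad_norm v x"
proof -
  let ?N = "{y. lattice_adj x y}"
  have sc: "L2_set (\<lambda>y. c * g y) ?N = \<bar>c\<bar> * L2_set g ?N" for c and g :: "_ \<Rightarrow> real"
    unfolding L2_set_def by (simp add: power_mult_distrib real_sqrt_mult flip: sum_distrib_left)
  have "L2_set (\<lambda>y. a * u y + b * v y - (a * u x + b * v x)) ?N
      = L2_set (\<lambda>y. a * (u y - u x) + b * (v y - v x)) ?N"
    by (simp add: algebra_simps)
  also have "\<dots> \<le> \<bar>a\<bar> * L2_set (\<lambda>y. u y - u x) ?N + \<bar>b\<bar> * L2_set (\<lambda>y. v y - v x) ?N"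
    using L2_set_triangle_ineq[of "\<lambda>y. a * (u y - u x)" "\<lambda>y. b * (v y - v x)" ?N] by (simp add: sc)
  finally have "L2_set (\<lambda>y. a * u y + b * v y - (a * u x + b * v x)) ?N / sqrt 2 \<le>
      (\<bar>a\<bar> * L2_set (\<lambda>y. u y - u x) ?N + \<bar>b\<bar> * L2_set (\<lambda>y. v y - v x) ?N) / sqrt 2"
    by (intro divide_right_mono) auto
  then show ?thesis unfolding grad_norm_L2 by (simp add: add_divide_distrib)
qed

lemma grad_norm_scale: "grad_norm (\<lambda>x. c * u x) x = \<bar>c\<bar> * grad_norm u x"
  unfolding grad_norm_def
  by (simp add: power_mult_distrib real_sqrt_mult real_sqrt_divide flip: right_diff_distrib sum_distrib_left)

lemma grad_prod_combine:
  "grad_prod u (\<lambda>x. a * v x + b * w x) x = a * grad_prod u v x + b * grad_prod u w x"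
  unfolding grad_prod_def
  by (simp add: sum_distrib_left algebra_simps flip: sum.distrib sum_subtractf)

lemma grad_norm_le_sum: "grad_norm u x \<le> (\<Sum>e | lattice_adj 0 e. \<bar>u (x + e)\<bar> + \<bar>u x\<bar>)"
proof -
  have "grad_norm u x \<le> L2_set (\<lambda>y. u y - u x) {y. lattice_adj x y}"
    unfolding grad_norm_L2 by (simp add: divide_le_eq mult_le_cancel_left1 L2_set_nonneg leD)
  also have "\<dots> \<le> (\<Sum>y | lattice_adj x y. \<bar>u y - u x\<bar>)" by (rule L2_set_le_sum_abs)
  also have "\<dots> \<le> (\<Sum>y | lattice_adj x y. \<bar>u y\<bar> + \<bar>u x\<bar>)" by (intro sum_mono) auto
  also have "\<dots> = (\<Sum>e | lattice_adj 0 e. \<bar>u (x + e)\<bar> + \<bar>u x\<bar>)" by (rule sum_neighbours)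
  finally show ?thesis .
qed

lemma tendsto_grad_norm:
  assumes "\<And>y. ((\<lambda>n. u n y) \<longlongrightarrow> v y) F"
  shows "((\<lambda>n. grad_norm (u n) x) \<longlongrightarrow> grad_norm v x) F"
  unfolding grad_norm_def by (intro tendsto_intros assms)

lemma tendsto_grad_prod:
  assumes "\<And>y. ((\<lambda>n. u n y) \<longlongrightarrow> v y) F" "\<And>y. ((\<lambda>n. u' n y) \<longlongrightarrow> v' y) F"
  shows "((\<lambda>n. grad_prod (u n) (u' n) x) \<longlongrightarrow> grad_prod v v' x) F"
  unfolding grad_prod_def by (intro tendsto_intros assms)

text \<open>This majorant of the gradient is monotone in |u|, so the one for u also serves every
  truncation of u.\<close>

lemma in_lp_grad_dominant:
  fixes u :: "int ^ 'n \<Rightarrow> real"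
  assumes "in_lp p u" "p \<ge> 0"
  shows "in_lp p (\<lambda>x. \<Sum>e | lattice_adj 0 e. \<bar>u (x + e)\<bar> + \<bar>u x\<bar>)"
  by (intro in_lp_sum in_lp_add in_lp_abs in_lp_translate finite_unit_steps assms)

lemma in_lp_grad_norm:
  fixes u :: "int ^ 'n \<Rightarrow> real"
  assumes "in_lp p u" "p \<ge> 0" shows "in_lp p (grad_norm u)"
proof (rule in_lp_mono[OF in_lp_grad_dominant[OF assms]])
  show "\<bar>grad_norm u x\<bar> \<le> \<bar>\<Sum>e | lattice_adj 0 e. \<bar>u (x + e)\<bar> + \<bar>u x\<bar>\<bar>" for x
    using grad_norm_le_sum[of u x] grad_norm_nonneg[of u x] by linarith
qed fact

text \<open>Bounded degree makes the gradient a bounded operation on l^p, so the completion is l^p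
  itself. Conversely, truncations of u to finite sets converge, since all truncation errors are
  dominated by one summable function.\<close>

lemma W1p_iff:
  fixes u :: "int ^ 'n \<Rightarrow> real"
  assumes p: "p \<ge> 1" shows "u \<in> W1p p \<longleftrightarrow> in_lp p u"
proof
  assume "u \<in> W1p p"
  then obtain \<phi> where fin: "finite {x. \<phi> (0::nat) x \<noteq> 0}" and
    s: "(\<lambda>x. grad_norm (\<lambda>z. u z - \<phi> 0 z) x powr p + \<bar>u x - \<phi> 0 x\<bar> powr p) summable_on UNIV"
    unfolding W1p_def by blast
  have "in_lp p (\<lambda>x. u x - \<phi> 0 x)" unfolding in_lp_def by (rule summable_real_bound[OF s]) auto
  from in_lp_add[OF this in_lp_finite[OF fin]] p show "in_lp p u" by simp
next
  assume u: "in_lp p u"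
  \<comment> \<open>An increasing exhaustion of the lattice by finite sets, taken from an
    enumeration.\<close>
  define A where "A k = {x :: int ^ 'n. to_nat x \<le> k}" for k :: nat
  define \<phi> where "\<phi> k x = (if x \<in> A k then u x else 0)" for k x
  have "finite (A k)" for k
    unfolding A_def using finite_vimageI[of "{..k}" "to_nat :: int ^ 'n \<Rightarrow> nat"]
    by (simp add: vimage_def)
  then have fin: "finite {x. \<phi> k x \<noteq> 0}" for k
    by (rule finite_subset[rotated]) (auto simp: \<phi>_def)
  let ?d = "\<lambda>k z. u z - \<phi> k z"
  let ?t = "\<lambda>k x. grad_norm (?d k) x powr p + \<bar>?d k x\<bar> powr p"
  have le: "\<bar>?d k x\<bar> \<le> \<bar>u x\<bar>" for k x by (simp add: \<phi>_def)
  have d0: "(\<lambda>k. ?d k x) \<longlonglongrightarrow> 0" for x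
  proof (rule tendsto_eventually)
    show "eventually (\<lambda>k. ?d k x = 0) sequentially"
      using eventually_ge_at_top[of "to_nat x"] by eventually_elim (simp add: \<phi>_def A_def)
  qed
  let ?G = "\<lambda>x. \<Sum>e | lattice_adj 0 e. \<bar>u (x + e)\<bar> + \<bar>u x\<bar>"
  have lim: "l1_lim ?t (\<lambda>x. 0)"
  proof (rule l1_lim_tight)
    fix x
    have "(\<lambda>k. \<bar>grad_norm (?d k) x\<bar> powr p + \<bar>?d k x\<bar> powr p) \<longlonglongrightarrow>
       \<bar>grad_norm (\<lambda>x. 0) x\<bar> powr p + \<bar>0\<bar> powr p"
      by (intro tendsto_add tendsto_abs_powr tendsto_grad_norm d0) (use p in auto)
    then show "(\<lambda>k. ?t k x) \<longlonglongrightarrow> 0" by (simp add: grad_norm_nonneg) (simp add: grad_norm_def)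
  next
    fix k x
    have "grad_norm (?d k) x \<le> ?G x"
      by (rule order_trans[OF grad_norm_le_sum]) (intro sum_mono add_mono le)
    moreover have "?G x \<ge> 0" by (intro sum_nonneg) auto
    ultimately have "grad_norm (?d k) x powr p \<le> \<bar>?G x\<bar> powr p"
      using p by (intro powr_mono2) (auto simp: grad_norm_nonneg)
    moreover have "\<bar>?d k x\<bar> powr p \<le> \<bar>u x\<bar> powr p" using p le by (intro powr_mono2) auto
    ultimately show "\<bar>?t k x\<bar> \<le> \<bar>?G x\<bar> powr p + \<bar>u x\<bar> powr p" by simp
  next
    have "(\<lambda>x. \<bar>?G x\<bar> powr p + \<bar>u x\<bar> powr p) summable_on UNIV"
      using in_lp_grad_dominant[OF u] u p unfolding in_lp_def by (intro summable_on_add) auto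
    then show "tight (\<lambda>k x. \<bar>?G x\<bar> powr p + \<bar>u x\<bar> powr p)" by (rule tight_const) simp
  qed
  then have "(\<lambda>k. \<bar>infsum (?t k) UNIV\<bar> powr (1/p)) \<longlonglongrightarrow> \<bar>0\<bar> powr (1/p)"
    using l1_lim_infsum[OF lim] p by (intro tendsto_abs_powr) auto
  then have "(\<lambda>k. W1p_norm p (?d k)) \<longlonglongrightarrow> 0"
    unfolding W1p_norm_def by (simp add: infsum_nonneg)
  then show "u \<in> W1p p"
    unfolding W1p_def using lim fin unfolding l1_lim_def by blast
qed

subsection \<open>The nonlinearity\<close>

lemma primitive_0: "primitive f 0 = 0"
  unfolding primitive_def by simp

lemma primitive_deriv:
  assumes "continuous_on UNIV f"
  shows "(primitive f has_real_derivative f t) (at t)"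
proof -
  \<comment> \<open>The extra 1 on each side puts t into the interior of the interval, so that the
    derivative within it becomes a two-sided one.\<close>
  define a b where "a = min 0 t - 1" and "b = max 0 t + 1"
  have "((\<lambda>u. LBINT y=ereal 0..ereal u. f y) has_vector_derivative f t) (at t within {a..b})"
    by (rule interval_integral_FTC2)
       (auto simp: a_def b_def intro: continuous_on_subset[OF assms])
  moreover have "t \<in> interior {a..b}" unfolding a_def b_def by auto
  ultimately show ?thesis
    unfolding primitive_def[abs_def] has_real_derivative_iff_has_vector_derivative
    by (simp only: at_within_interior)
qed

text \<open>The little-o condition gives the bound with constant 1 for |s| < d; on the compact
  remainder f is bounded and |s| powr (p - 1) is at least d powr (p - 1). Since l^p functions on the
  lattice are bounded, a bound on each [-M, M] is all that will be asked of f.\<close>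

lemma smallo_power_bound:
  fixes f :: "real \<Rightarrow> real"
  assumes p: "p > 1" and cont: "continuous_on UNIV f" and o: "f \<in> o[at 0](\<lambda>t. \<bar>t\<bar> powr (p - 1))"
  shows "\<exists>C>0. \<forall>s. \<bar>s\<bar> \<le> M \<longrightarrow> \<bar>f s\<bar> \<le> C * \<bar>s\<bar> powr (p - 1)"
proof -
  have ev: "eventually (\<lambda>s. \<bar>f s\<bar> \<le> \<bar>s\<bar> powr (p - 1)) (at 0)"
    using landau_o.smallD[OF o, of 1] by simp
  then obtain d where d: "d > 0" "\<And>s. s \<noteq> 0 \<Longrightarrow> \<bar>s\<bar> < d \<Longrightarrow> \<bar>f s\<bar> \<le> \<bar>s\<bar> powr (p - 1)"
    unfolding eventually_at by (auto simp: dist_real_def)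
  have l1: "((\<lambda>s. \<bar>f s\<bar>) \<longlongrightarrow> \<bar>f 0\<bar>) (at 0)"
    using cont by (intro tendsto_intros) (simp add: continuous_on_def)
  have l2: "((\<lambda>s::real. \<bar>s\<bar> powr (p - 1)) \<longlongrightarrow> \<bar>0\<bar> powr (p - 1)) (at 0)"
    using p by (intro tendsto_abs_powr tendsto_ident_at) auto
  \<comment> \<open>The little-o condition speaks only of a punctured neighbourhood; the value at 0
    comes from continuity.\<close>
  have "\<bar>f 0\<bar> \<le> \<bar>0\<bar> powr (p - 1)"
    by (rule tendsto_le[OF _ l2 l1 ev]) simp
  then have f0: "f 0 = 0" by simp
  have "compact (f ` {-M..M})"
    using cont by (intro compact_continuous_image) (auto intro: continuous_on_subset)
  then obtain K where K: "\<And>s. \<bar>s\<bar> \<le> M \<Longrightarrow> \<bar>f s\<bar> \<le> K"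
    by (force dest!: compact_imp_bounded simp: bounded_iff abs_le_iff)
  let ?C = "1 + \<bar>K\<bar> / d powr (p - 1)"
  have "\<bar>f s\<bar> \<le> ?C * \<bar>s\<bar> powr (p - 1)" if s: "\<bar>s\<bar> \<le> M" for s
  proof (cases "\<bar>s\<bar> < d")
    case True
    then have "\<bar>f s\<bar> \<le> 1 * \<bar>s\<bar> powr (p - 1)" using d(2)[of s] f0 by (cases "s = 0") auto
    also have "\<dots> \<le> ?C * \<bar>s\<bar> powr (p - 1)" by (intro mult_right_mono) auto
    finally show ?thesis .
  next
    case False
    have "\<bar>f s\<bar> \<le> \<bar>K\<bar> / d powr (p - 1) * d powr (p - 1)" using K[OF s] d(1) by simp
    also have "\<dots> \<le> \<bar>K\<bar> / d powr (p - 1) * \<bar>s\<bar> powr (p - 1)"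
      using False d(1) p by (intro mult_left_mono powr_mono2) auto
    also have "\<dots> \<le> ?C * \<bar>s\<bar> powr (p - 1)" by (intro mult_right_mono) auto
    finally show ?thesis .
  qed
  moreover have "?C > 0" by (intro add_pos_nonneg) auto
  ultimately show ?thesis by blast
qed

text \<open>Mean value inequality. The Lipschitz constant keeps the power of r, because r will be
  chosen at each lattice point and the bound has to be summable there.\<close>

lemma primitive_diff_bound:
  assumes "continuous_on UNIV f" "\<And>s. \<bar>s\<bar> \<le> r \<Longrightarrow> \<bar>f s\<bar> \<le> C * \<bar>s\<bar> powr q"
    and "\<bar>a\<bar> \<le> r" "\<bar>b\<bar> \<le> r" "q \<ge> 0" "C \<ge> 0"
  shows "\<bar>primitive f a - primitive f b\<bar> \<le> C * r powr q * \<bar>a - b\<bar>"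
proof -
  have "norm (primitive f a - primitive f b) \<le> (C * r powr q) * norm (a - b)"
  proof (rule field_differentiable_bound[of "{-r..r}"])
    fix z assume z: "z \<in> {-r..r}"
    show "(primitive f has_field_derivative f z) (at z within {-r..r})"
      using primitive_deriv[OF assms(1)] by (rule has_field_derivative_at_within)
    have "\<bar>z\<bar> \<le> r" using z by auto
    then have "\<bar>f z\<bar> \<le> C * \<bar>z\<bar> powr q" by (rule assms(2))
    also have "\<dots> \<le> C * r powr q" using z assms by (intro mult_left_mono powr_mono2) auto
    finally show "norm (f z) \<le> C * r powr q" by simp
  qed (use assms in auto)
  then show ?thesis by simp
qed

text \<open>For p = 2 the factor g powr (p - 2) is discontinuous at 0, where 0 powr 0 = 0, and the
  product rule for limits fails. The bound on q supplies one more factor g, leaving the exponent p -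
  1 > 0.\<close>

lemma tendsto_powr_mult:
  fixes g q :: "nat \<Rightarrow> real"
  assumes g: "g \<longlonglongrightarrow> g'" and q: "q \<longlonglongrightarrow> q'" and bd: "\<And>n. \<bar>q n\<bar> \<le> g n * c"
    and nn: "\<And>n. g n \<ge> 0" and p: "p \<ge> 2"
  shows "(\<lambda>n. g n powr (p - 2) * q n) \<longlonglongrightarrow> g' powr (p - 2) * q'"
proof (cases "g' = 0")
  case False
  then show ?thesis by (intro tendsto_intros g q) auto
next
  case True
  have "(\<lambda>n. \<bar>g n\<bar> powr (p - 1) * c) \<longlonglongrightarrow> \<bar>g'\<bar> powr (p - 1) * c"
    using p by (intro tendsto_mult_right tendsto_abs_powr g) auto
  then have z: "(\<lambda>n. g n powr (p - 1) * c) \<longlonglongrightarrow> 0" using True nn by simp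
  have "\<bar>g n powr (p - 2) * q n\<bar> \<le> g n powr (p - 1) * c" for n
  proof -
    have "\<bar>g n powr (p - 2) * q n\<bar> \<le> g n powr (p - 2) * (g n * c)"
      unfolding abs_mult using bd by (intro mult_mono) auto
    then show ?thesis using powr_mult_self[OF nn, of n "p-1"] by (simp flip: mult.assoc)
  qed
  then have "(\<lambda>n. g n powr (p - 2) * q n) \<longlonglongrightarrow> 0"
    by (intro tendsto_rabs_zero_cancel[OF tendsto_sandwich[OF _ _ tendsto_const z]]) auto
  then show ?thesis using True by simp
qed

subsection \<open>The energy and its derivative\<close>

text \<open>The analytic hypotheses in distilled form: condition (2) as \<open>sublevel\<close>,
  continuity and condition (3) as \<open>f_growth\<close>, and the Green's function only as a
  bounded symmetric kernel.\<close>

locale choquard =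
  bounded_kernel "green \<alpha> :: int ^ 'n \<Rightarrow> int ^ 'n \<Rightarrow> real" B for \<alpha> B +
  fixes p h\<^sub>0 :: real and h :: "int ^ 'n \<Rightarrow> real" and f :: "real \<Rightarrow> real"
  assumes p2: "p \<ge> 2" and h0: "h\<^sub>0 > 0" and h_ge: "h x \<ge> h\<^sub>0"
    and sublevel: "finite {x. h x < Z}"
    and cont: "continuous_on UNIV f"
    and f_growth: "\<exists>C>0. \<forall>s. \<bar>s\<bar> \<le> M \<longrightarrow> \<bar>f s\<bar> \<le> C * \<bar>s\<bar> powr (p - 1)"
begin

abbreviation "F \<equiv> primitive f"
abbreviation "H \<equiv> H_space p h"

text \<open>The pairing <Phi'(u), \<phi>>; see \<open>Phi_deriv\<close>.\<close>

definition D :: "(int ^ 'n \<Rightarrow> real) \<Rightarrow> (int ^ 'n \<Rightarrow> real) \<Rightarrow> real" where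
  "D u \<phi> = kernel_form (green \<alpha>) (\<lambda>x. F (u x)) (\<lambda>x. f (u x) * \<phi> x)"
definition Phi :: "(int ^ 'n \<Rightarrow> real) \<Rightarrow> real" where
  "Phi u = kernel_form (green \<alpha>) (\<lambda>x. F (u x)) (\<lambda>x. F (u x)) / 2"
text \<open>\<open>S u\<close> is the p-th power of the norm of \<open>H\<close>, and
  \<open>Nd u \<phi>\<close> the derivative of S/p at u in direction \<phi>; \<open>T\<close> and
  \<open>Nt\<close> are their densities.\<close>

definition "T u x = grad_norm u x powr p + h x * \<bar>u x\<bar> powr p"
definition "S u = infsum (T u) UNIV"
definition "Nt u \<phi> x = grad_norm u x powr (p - 2) * grad_prod u \<phi> x
            + h x * \<bar>u x\<bar> powr (p - 2) * u x * \<phi> x"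
definition "Nd u \<phi> = infsum (Nt u \<phi>) UNIV"

lemma h_pos: "h x > 0" using h0 h_ge[of x] by linarith

lemma T_nonneg: "T u x \<ge> 0"
  unfolding T_def using h_pos[of x] by (intro add_nonneg_nonneg) auto

lemma S_nonneg: "S u \<ge> 0"
  unfolding S_def by (intro infsum_nonneg T_nonneg)

lemma energy_eq: "energy p \<alpha> h f u = S u / p - Phi u"
proof -
  have "H_norm p h u powr p = S u"
    unfolding H_norm_def using p2 S_nonneg[of u] by (simp add: powr_powr flip: T_def S_def)
  then show ?thesis
    unfolding energy_def Phi_def kernel_form_def green_conv_def by simp
qed

lemma energy_deriv_eq: "energy_deriv p \<alpha> h f u \<phi> = Nd u \<phi> - D u \<phi>"
  unfolding energy_deriv_def Nd_def Nt_def D_def kernel_form_def green_conv_def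
  by (simp add: mult.assoc)

section \<open>The energy space as a weighted sequence space\<close>

lemma summable_h_imp_in_lp:
  assumes "(\<lambda>x. h x * \<bar>u x\<bar> powr p) summable_on UNIV" shows "in_lp p u"
  unfolding in_lp_def
proof (rule summable_real_bound)
  show "(\<lambda>x. (1 / h\<^sub>0) * (h x * \<bar>u x\<bar> powr p)) summable_on UNIV"
    by (intro summable_on_cmult_right assms)
  show "\<bar>\<bar>u x\<bar> powr p\<bar> \<le> (1 / h\<^sub>0) * (h x * \<bar>u x\<bar> powr p)" for x
    using h0 mult_right_mono[OF h_ge[of x], of "\<bar>u x\<bar> powr p"] by (simp add: field_simps)
qed

lemma H_iff: "u \<in> H \<longleftrightarrow> (\<lambda>x. h x * \<bar>u x\<bar> powr p) summable_on UNIV"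
  unfolding H_space_def using W1p_iff[of p u] p2 summable_h_imp_in_lp[of u] by auto

lemma H_in_lp: "u \<in> H \<Longrightarrow> in_lp p u"
  using summable_h_imp_in_lp H_iff by blast

lemma T_summable: "u \<in> H \<Longrightarrow> T u summable_on UNIV"
  unfolding T_def using in_lp_grad_norm[OF H_in_lp, of u] p2
  by (intro summable_on_add) (auto simp: in_lp_def H_iff grad_norm_nonneg)

lemma T_summable_imp_H:
  assumes "T u summable_on UNIV" shows "u \<in> H"
  unfolding H_iff
  by (rule summable_real_bound[OF assms]) (use h_pos in \<open>auto simp: T_def abs_mult less_imp_le\<close>)

text \<open>The constant depends only on a bound c for the coefficients, so T v + T w dominates a
  whole sequence of combinations at once.\<close>

lemma T_combine:
  assumes "\<bar>a\<bar> \<le> c" "\<bar>b\<bar> \<le> c"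
  shows "T (\<lambda>x. a * v x + b * w x) x \<le> 2 powr p * c powr p * (T v x + T w x)"
proof -
  have c: "c \<ge> 0" using assms by linarith
  have gen: "y powr p \<le> 2 powr p * c powr p * (s powr p + t powr p)"
    if "y \<ge> 0" "s \<ge> 0" "t \<ge> 0" "y \<le> \<bar>a\<bar> * s + \<bar>b\<bar> * t" for y s t
  proof -
    have "y \<le> c * (s + t)"
      using that assms mult_right_mono[of "\<bar>a\<bar>" c s] mult_right_mono[of "\<bar>b\<bar>" c t]
      by (simp add: distrib_left)
    then have "y powr p \<le> (c * (s + t)) powr p" using that p2 by (intro powr_mono2) auto
    also have "\<dots> = c powr p * (s + t) powr p" using that c by (simp add: powr_mult)
    also have "\<dots> \<le> c powr p * (2 powr p * (s powr p + t powr p))"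
      using that p2 by (intro mult_left_mono powr_add_le) auto
    finally show ?thesis by (simp add: mult_ac)
  qed
  have "grad_norm (\<lambda>x. a * v x + b * w x) x powr p
      \<le> 2 powr p * c powr p * (grad_norm v x powr p + grad_norm w x powr p)"
    by (intro gen grad_norm_nonneg grad_norm_combine)
  moreover have "h x * \<bar>a * v x + b * w x\<bar> powr p \<le> h x * (2 powr p * c powr p * (\<bar>v x\<bar> powr p + \<bar>w x\<bar> powr p))"
    using h_pos[of x] by (intro mult_left_mono gen) (auto intro: order_trans[OF abs_triangle_ineq] simp: abs_mult)
  ultimately show ?thesis unfolding T_def by (simp add: algebra_simps)
qed

lemma H_combine:
  assumes "v \<in> H" "w \<in> H" shows "(\<lambda>x. a * v x + b * w x) \<in> H"
proof (rule T_summable_imp_H)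
  let ?c = "max \<bar>a\<bar> \<bar>b\<bar>"
  show "T (\<lambda>x. a * v x + b * w x) summable_on UNIV"
  proof (rule summable_real_bound)
    show "(\<lambda>x. 2 powr p * ?c powr p * (T v x + T w x)) summable_on UNIV"
      by (intro summable_on_cmult_right summable_on_add T_summable assms)
    show "\<bar>T (\<lambda>x. a * v x + b * w x) x\<bar> \<le> 2 powr p * ?c powr p * (T v x + T w x)" for x
      using T_combine[of a ?c b v w x] T_nonneg[of _ x] by simp
  qed
qed

lemma H_scale: "v \<in> H \<Longrightarrow> (\<lambda>x. a * v x) \<in> H"
  using H_combine[of v v a 0] by simp

lemma T_scale: "T (\<lambda>x. c * u x) x = \<bar>c\<bar> powr p * T u x"
  unfolding T_def by (simp add: grad_norm_scale abs_mult powr_mult grad_norm_nonneg algebra_simps)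

lemma S_scale: "S (\<lambda>x. c * u x) = \<bar>c\<bar> powr p * S u"
  unfolding S_def T_scale[abs_def] by (rule infsum_cmult_right')

lemma S_pos:
  assumes "u \<in> H" "u \<noteq> (\<lambda>_. 0)" shows "S u > 0"
proof -
  obtain x where x: "u x \<noteq> 0" using assms(2) by blast
  then have "0 < h x * \<bar>u x\<bar> powr p" using h_pos[of x] by simp
  also have "\<dots> \<le> T u x" unfolding T_def by simp
  also have "\<dots> \<le> S u" unfolding S_def
    using finite_sum_le_infsum[OF T_summable[OF assms(1)], of "{x}"] T_nonneg by simp
  finally show ?thesis .
qed

lemma sum_powr_le_S:
  assumes "u \<in> H" shows "in_lp p u" "h\<^sub>0 * (\<Sum>\<^sub>\<infinity>x. \<bar>u x\<bar> powr p) \<le> S u"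
proof -
  show l: "in_lp p u" by (rule H_in_lp[OF assms])
  have "(\<Sum>\<^sub>\<infinity>x. h\<^sub>0 * \<bar>u x\<bar> powr p) \<le> S u"
    unfolding S_def
  proof (rule infsum_mono)
    show "(\<lambda>x. h\<^sub>0 * \<bar>u x\<bar> powr p) summable_on UNIV"
      using l unfolding in_lp_def by (rule summable_on_cmult_right)
    fix x
    have "h\<^sub>0 * \<bar>u x\<bar> powr p \<le> h x * \<bar>u x\<bar> powr p" using h_ge by (intro mult_right_mono) auto
    then show "h\<^sub>0 * \<bar>u x\<bar> powr p \<le> T u x" unfolding T_def by (simp add: add_increasing)
  qed (rule T_summable[OF assms])
  then show "h\<^sub>0 * (\<Sum>\<^sub>\<infinity>x. \<bar>u x\<bar> powr p) \<le> S u" by (simp add: infsum_cmult_right')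
qed

lemma pointwise_bound:
  assumes "u \<in> H" "S u \<le> K" shows "\<bar>u x\<bar> \<le> (K / h\<^sub>0) powr (1/p)"
proof -
  have "\<bar>u x\<bar> powr p \<le> (\<Sum>\<^sub>\<infinity>x. \<bar>u x\<bar> powr p)"
    using finite_sum_le_infsum[of "\<lambda>x. \<bar>u x\<bar> powr p" UNIV "{x}"] H_in_lp[OF assms(1)]
    by (simp add: in_lp_def)
  also have "\<dots> \<le> K / h\<^sub>0" using sum_powr_le_S(2)[OF assms(1)] assms(2) h0 by (simp add: field_simps)
  finally have "(\<bar>u x\<bar> powr p) powr (1/p) \<le> (K / h\<^sub>0) powr (1/p)"
    using p2 by (intro powr_mono2) auto
  then show ?thesis using p2 by (simp add: powr_powr)
qed

section \<open>The derivative of the norm part\<close>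

lemma Nt_self: "Nt u u x = T u x"
proof -
  have "grad_norm u x powr (p - 2) * (grad_norm u x)\<^sup>2 = grad_norm u x powr p"
    using powr_mult_self[OF grad_norm_nonneg, of u x "p - 1"] powr_mult_self[OF grad_norm_nonneg, of u x p]
    by (simp add: power2_eq_square flip: mult.assoc)
  moreover have "\<bar>u x\<bar> powr (p - 2) * (u x * u x) = \<bar>u x\<bar> powr (p - 1 - 1) * \<bar>u x\<bar> * \<bar>u x\<bar>"
    by (simp add: mult.assoc)
  then have "\<bar>u x\<bar> powr (p - 2) * (u x * u x) = \<bar>u x\<bar> powr p"
    by (simp only: powr_mult_self abs_ge_zero)
  ultimately show ?thesis unfolding Nt_def T_def by (simp add: grad_prod_self mult.assoc)
qed

lemma Nd_self: "Nd u u = S u"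
  unfolding Nd_def S_def by (intro infsum_cong Nt_self)

lemma Nt_parts:
  "\<bar>grad_norm u x powr (p - 2) * grad_prod u \<phi> x\<bar> \<le> grad_norm u x powr (p - 1) * grad_norm \<phi> x"
  "\<bar>h x * \<bar>u x\<bar> powr (p - 2) * u x * \<phi> x\<bar> = h x * (\<bar>u x\<bar> powr (p - 1) * \<bar>\<phi> x\<bar>)"
proof -
  have "\<bar>grad_norm u x powr (p - 2) * grad_prod u \<phi> x\<bar> \<le>
      grad_norm u x powr (p - 2) * (grad_norm u x * grad_norm \<phi> x)"
    unfolding abs_mult by (intro mult_mono grad_prod_CS) auto
  then show "\<bar>grad_norm u x powr (p - 2) * grad_prod u \<phi> x\<bar> \<le> grad_norm u x powr (p - 1) * grad_norm \<phi> x"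
    using powr_mult_self[OF grad_norm_nonneg, of u x "p - 1"] by (simp flip: mult.assoc)
  have "\<bar>h x * \<bar>u x\<bar> powr (p - 2) * u x * \<phi> x\<bar> = h x * (\<bar>u x\<bar> powr (p - 1 - 1) * \<bar>u x\<bar> * \<bar>\<phi> x\<bar>)"
    using h_pos[of x] by (simp add: abs_mult mult.assoc)
  then show "\<bar>h x * \<bar>u x\<bar> powr (p - 2) * u x * \<phi> x\<bar> = h x * (\<bar>u x\<bar> powr (p - 1) * \<bar>\<phi> x\<bar>)"
    by (simp only: powr_mult_self abs_ge_zero)
qed

lemma Nt_bound: "\<bar>Nt u \<phi> x\<bar> \<le> T u x + T \<phi> x"
proof -
  have "\<bar>Nt u \<phi> x\<bar> \<le> grad_norm u x powr (p - 1) * grad_norm \<phi> x + h x * (\<bar>u x\<bar> powr (p - 1) * \<bar>\<phi> x\<bar>)"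
    unfolding Nt_def using Nt_parts(1)[of u x \<phi>] Nt_parts(2)[of x u \<phi>] by linarith
  also have "\<dots> \<le> (grad_norm u x powr p + grad_norm \<phi> x powr p) + h x * (\<bar>u x\<bar> powr p + \<bar>\<phi> x\<bar> powr p)"
    using p2 h_pos[of x] by (intro add_mono mult_left_mono powr_mult_le grad_norm_nonneg) auto
  finally show ?thesis unfolding T_def by (simp add: algebra_simps)
qed

lemma Nt_Young: "Nt u \<phi> x \<le> (1 - 1/p) * T u x + 1/p * T \<phi> x"
proof -
  have "Nt u \<phi> x \<le> grad_norm u x powr (p - 1) * grad_norm \<phi> x + h x * (\<bar>u x\<bar> powr (p - 1) * \<bar>\<phi> x\<bar>)"
    unfolding Nt_def using Nt_parts(1)[of u x \<phi>] Nt_parts(2)[of x u \<phi>] by linarith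
  also have "\<dots> \<le> ((1 - 1/p) * grad_norm u x powr p + 1/p * grad_norm \<phi> x powr p)
      + h x * ((1 - 1/p) * \<bar>u x\<bar> powr p + 1/p * \<bar>\<phi> x\<bar> powr p)"
    using p2 h_pos[of x] by (intro add_mono mult_left_mono powr_Young grad_norm_nonneg) auto
  finally show ?thesis unfolding T_def by (simp add: algebra_simps)
qed

lemma Nt_summable: "u \<in> H \<Longrightarrow> \<phi> \<in> H \<Longrightarrow> Nt u \<phi> summable_on UNIV"
  by (rule summable_real_bound[OF summable_on_add[OF T_summable[of u] T_summable[of \<phi>]]]) (auto intro: Nt_bound)

text \<open>Convexity of S/p in disguise: since \<open>Nd u u = S u\<close>, this is the tangent
  inequality S(\<phi>)/p >= S(u)/p + Nd u (\<phi> - u).\<close>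

lemma Nd_Young:
  assumes "u \<in> H" "\<phi> \<in> H" shows "Nd u \<phi> \<le> (1 - 1/p) * S u + 1/p * S \<phi>"
proof -
  have "Nd u \<phi> \<le> (\<Sum>\<^sub>\<infinity>x. (1 - 1/p) * T u x + 1/p * T \<phi> x)"
    unfolding Nd_def using assms
    by (intro infsum_mono Nt_summable summable_on_add summable_on_cmult_right T_summable Nt_Young)
  also have "\<dots> = (1 - 1/p) * S u + 1/p * S \<phi>"
    unfolding S_def infsum_cmult_right'[symmetric]
    by (rule infsum_add; intro summable_on_cmult_right T_summable assms)
  finally show ?thesis .
qed

lemma Nt_combine: "Nt u (\<lambda>x. a * v x + b * w x) x = a * Nt u v x + b * Nt u w x"
  unfolding Nt_def grad_prod_combine by (simp add: algebra_simps)

lemma Nd_combine: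
  assumes "u \<in> H" "v \<in> H" "w \<in> H"
  shows "Nd u (\<lambda>x. a * v x + b * w x) = a * Nd u v + b * Nd u w"
  unfolding Nd_def Nt_combine[abs_def]
  by (subst infsum_add) (auto simp: infsum_cmult_right' intro!: summable_on_cmult_right Nt_summable assms)

text \<open>Continuity inside the span of two fixed functions is enough for the variations used
  later, and there \<open>T_combine\<close> provides a majorant that does not depend on n.\<close>

lemma Nd_tendsto:
  assumes v: "v \<in> H" and w: "w \<in> H" and \<phi>: "\<phi> \<in> H" and a: "a \<longlonglongrightarrow> a'" and b: "b \<longlonglongrightarrow> b'"
  shows "(\<lambda>n. Nd (\<lambda>x. a n * v x + b n * w x) \<phi>) \<longlonglongrightarrow> Nd (\<lambda>x. a' * v x + b' * w x) \<phi>"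
proof -
  let ?u = "\<lambda>n x. a n * v x + b n * w x" and ?u' = "\<lambda>x. a' * v x + b' * w x"
  obtain c1 where c1: "\<And>n. \<bar>a n\<bar> \<le> c1" using convergent_imp_Bseq[OF convergentI[OF a]] by (auto simp: Bseq_def)
  obtain c2 where c2: "\<And>n. \<bar>b n\<bar> \<le> c2" using convergent_imp_Bseq[OF convergentI[OF b]] by (auto simp: Bseq_def)
  define c where "c = max c1 c2"
  have c: "\<bar>a n\<bar> \<le> c" "\<bar>b n\<bar> \<le> c" for n using c1[of n] c2[of n] unfolding c_def by auto
  have lu: "(\<lambda>n. ?u n x) \<longlonglongrightarrow> ?u' x" for x by (intro tendsto_intros a b)
  have "l1_lim (\<lambda>n. Nt (?u n) \<phi>) (Nt ?u' \<phi>)"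
  proof (rule l1_lim_tight)
    show "(\<lambda>n. Nt (?u n) \<phi> x) \<longlonglongrightarrow> Nt ?u' \<phi> x" for x
      unfolding Nt_def mult.assoc[of "h x"]
      by (intro tendsto_add tendsto_mult[OF tendsto_const] tendsto_mult[OF _ tendsto_const]
            tendsto_powr_mult[where c = "grad_norm \<phi> x"] tendsto_powr_mult[where c = 1]
            tendsto_grad_norm tendsto_grad_prod tendsto_const lu grad_norm_nonneg grad_prod_CS p2
            tendsto_rabs) auto
    show "\<bar>Nt (?u n) \<phi> x\<bar> \<le> 2 powr p * c powr p * (T v x + T w x) + T \<phi> x" for n x
      using Nt_bound[of "?u n" \<phi> x] T_combine[OF c(1)[of n] c(2)[of n], of v w x] by linarith
    show "tight (\<lambda>n x. 2 powr p * c powr p * (T v x + T w x) + T \<phi> x)"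
      by (rule tight_const)
         (auto intro!: summable_on_add summable_on_cmult_right T_summable v w \<phi> add_nonneg_nonneg mult_nonneg_nonneg T_nonneg)
  qed
  then show ?thesis unfolding Nd_def by (rule l1_lim_infsum)
qed

end

subsection \<open>Continuity and differentiability of the nonlocal term\<close>

context choquard
begin

lemma F_growth: "\<exists>C>0. \<forall>s. \<bar>s\<bar> \<le> M \<longrightarrow> \<bar>f s\<bar> \<le> C * \<bar>s\<bar> powr (p - 1) \<and> \<bar>F s\<bar> \<le> C * \<bar>s\<bar> powr p"
proof -
  obtain C where C: "C > 0" "\<And>s. \<bar>s\<bar> \<le> M \<Longrightarrow> \<bar>f s\<bar> \<le> C * \<bar>s\<bar> powr (p - 1)"
    using f_growth[of M] by blast
  have "\<bar>F s\<bar> \<le> C * \<bar>s\<bar> powr p" if "\<bar>s\<bar> \<le> M" for s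
  proof -
    have "\<bar>F s - F 0\<bar> \<le> C * \<bar>s\<bar> powr (p - 1) * \<bar>s - 0\<bar>"
      using C p2 that by (intro primitive_diff_bound cont) auto
    then show ?thesis by (simp add: primitive_0 mult.assoc powr_mult_self)
  qed
  then show ?thesis using C by blast
qed

text \<open>Pointwise convergence with tight p-th powers amounts to convergence in l^p. The uniform
  bound lets one constant from \<open>F_growth\<close> serve all n and x.\<close>

definition lp_lim :: "(nat \<Rightarrow> (int ^ 'n) \<Rightarrow> real) \<Rightarrow> ((int ^ 'n) \<Rightarrow> real) \<Rightarrow> bool" where
  "lp_lim u v \<longleftrightarrow> (\<forall>x. (\<lambda>n. u n x) \<longlonglongrightarrow> v x) \<and> tight (\<lambda>n x. \<bar>u n x\<bar> powr p) \<and>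
     (\<exists>M. \<forall>n x. \<bar>u n x\<bar> \<le> M)"

lemma lp_lim_combine:
  assumes v: "in_lp p v" and w: "in_lp p w" and a: "a \<longlonglongrightarrow> a'" and b: "b \<longlonglongrightarrow> b'"
  shows "lp_lim (\<lambda>n x. a n * v x + b n * w x) (\<lambda>x. a' * v x + b' * w x)"
proof -
  obtain c1 where c1: "\<And>n. \<bar>a n\<bar> \<le> c1" using convergent_imp_Bseq[OF convergentI[OF a]] by (auto simp: Bseq_def)
  obtain c2 where c2: "\<And>n. \<bar>b n\<bar> \<le> c2" using convergent_imp_Bseq[OF convergentI[OF b]] by (auto simp: Bseq_def)
  let ?U = "\<lambda>x. c1 * \<bar>v x\<bar> + c2 * \<bar>w x\<bar>"
  have U: "in_lp p ?U" using p2 by (intro in_lp_add in_lp_scale in_lp_abs v w) auto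
  have le: "\<bar>a n * v x + b n * w x\<bar> \<le> \<bar>?U x\<bar>" for n x
  proof -
    have "\<bar>a n * v x + b n * w x\<bar> \<le> \<bar>a n\<bar> * \<bar>v x\<bar> + \<bar>b n\<bar> * \<bar>w x\<bar>"
      by (rule order_trans[OF abs_triangle_ineq]) (simp add: abs_mult)
    also have "\<dots> \<le> ?U x" by (intro add_mono mult_right_mono c1 c2) auto
    finally show ?thesis by simp
  qed
  have "tight (\<lambda>n x. \<bar>?U x\<bar> powr p)" using U unfolding in_lp_def by (intro tight_const) auto
  then have t: "tight (\<lambda>n x. \<bar>a n * v x + b n * w x\<bar> powr p)"
    by (rule tight_mono[where C = 1]) (use p2 le in \<open>auto intro!: powr_mono2\<close>)
  obtain M where "\<And>x. \<bar>?U x\<bar> \<le> M" using in_lp_bounded[OF U] p2 by auto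
  then have "\<exists>M. \<forall>n x. \<bar>a n * v x + b n * w x\<bar> \<le> M" using le order_trans by blast
  moreover have "(\<lambda>n. a n * v x + b n * w x) \<longlonglongrightarrow> a' * v x + b' * w x" for x
    by (intro tendsto_intros a b)
  ultimately show ?thesis unfolding lp_lim_def using t by blast
qed

lemma lp_lim_const: "in_lp p v \<Longrightarrow> lp_lim (\<lambda>n. v) v"
  using lp_lim_combine[of v v "\<lambda>_. 1" 1 "\<lambda>_. 0" 0] by simp

lemma lp_lim_scale: "in_lp p v \<Longrightarrow> a \<longlonglongrightarrow> a' \<Longrightarrow> lp_lim (\<lambda>n x. a n * v x) (\<lambda>x. a' * v x)"
  using lp_lim_combine[of v v a a' "\<lambda>_. 0" 0] by simp

lemma l1_lim_F:
  assumes "lp_lim u v" shows "l1_lim (\<lambda>n x. F (u n x)) (\<lambda>x. F (v x))"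
proof -
  have lim: "\<And>x. (\<lambda>n. u n x) \<longlonglongrightarrow> v x" and t: "tight (\<lambda>n x. \<bar>u n x\<bar> powr p)"
    using assms unfolding lp_lim_def by auto
  obtain M where M: "\<And>n x. \<bar>u n x\<bar> \<le> M" using assms unfolding lp_lim_def by auto
  obtain C where C: "C > 0" "\<And>s. \<bar>s\<bar> \<le> M \<Longrightarrow> \<bar>F s\<bar> \<le> C * \<bar>s\<bar> powr p" using F_growth[of M] by auto
  show ?thesis
  proof (rule l1_lim_tight)
    show "(\<lambda>n. F (u n x)) \<longlonglongrightarrow> F (v x)" for x
      by (rule isCont_tendsto_compose[OF DERIV_isCont[OF primitive_deriv[OF cont]] lim])
    show "tight (\<lambda>n x. C * \<bar>u n x\<bar> powr p)" by (rule tight_mono[OF t]) (use C in auto)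
  qed (rule C(2)[OF M])
qed

lemma l1_lim_f:
  assumes u: "lp_lim u v" and w: "lp_lim w z"
  shows "l1_lim (\<lambda>n x. f (u n x) * w n x) (\<lambda>x. f (v x) * z x)"
proof -
  have lim: "\<And>x. (\<lambda>n. u n x) \<longlonglongrightarrow> v x" "\<And>x. (\<lambda>n. w n x) \<longlonglongrightarrow> z x"
    and t: "tight (\<lambda>n x. \<bar>u n x\<bar> powr p)" "tight (\<lambda>n x. \<bar>w n x\<bar> powr p)"
    using assms unfolding lp_lim_def by auto
  obtain M where M: "\<And>n x. \<bar>u n x\<bar> \<le> M" using u unfolding lp_lim_def by auto
  obtain C where C: "C > 0" "\<And>s. \<bar>s\<bar> \<le> M \<Longrightarrow> \<bar>f s\<bar> \<le> C * \<bar>s\<bar> powr (p - 1)"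
    using F_growth[of M] by auto
  show ?thesis
  proof (rule l1_lim_tight)
    show "(\<lambda>n. f (u n x) * w n x) \<longlonglongrightarrow> f (v x) * z x" for x
      by (intro tendsto_mult continuous_on_tendsto_compose[OF cont lim(1)] lim) auto
    show "tight (\<lambda>n x. C * (\<bar>u n x\<bar> powr p + \<bar>w n x\<bar> powr p))"
      by (rule tight_mono[OF tight_add[OF t]]) (use C in auto)
    fix n x
    have "\<bar>f (u n x) * w n x\<bar> \<le> C * \<bar>u n x\<bar> powr (p - 1) * \<bar>w n x\<bar>"
      unfolding abs_mult by (intro mult_right_mono C M) auto
    also have "\<dots> \<le> C * (\<bar>u n x\<bar> powr p + \<bar>w n x\<bar> powr p)"
      unfolding mult.assoc using C p2 by (intro mult_left_mono powr_mult_le) auto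
    finally show "\<bar>f (u n x) * w n x\<bar> \<le> C * (\<bar>u n x\<bar> powr p + \<bar>w n x\<bar> powr p)" .
  qed
qed

lemma D_tendsto: "lp_lim u v \<Longrightarrow> lp_lim w z \<Longrightarrow> (\<lambda>n. D (u n) (w n)) \<longlonglongrightarrow> D v z"
  unfolding D_def by (intro form_tendsto l1_lim_F l1_lim_f)

lemma Phi_tendsto: "lp_lim u v \<Longrightarrow> (\<lambda>n. Phi (u n)) \<longlonglongrightarrow> Phi v"
  unfolding Phi_def by (intro tendsto_divide form_tendsto l1_lim_F tendsto_const) auto

lemma F_summable: "in_lp p (u :: int ^ 'n \<Rightarrow> real) \<Longrightarrow> (\<lambda>x. F (u x)) summable_on UNIV"
  using l1_lim_F[OF lp_lim_const] unfolding l1_lim_def by blast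

lemma f_summable: "in_lp p (u :: int ^ 'n \<Rightarrow> real) \<Longrightarrow> in_lp p w \<Longrightarrow> (\<lambda>x. f (u x) * w x) summable_on UNIV"
  using l1_lim_f[OF lp_lim_const lp_lim_const] unfolding l1_lim_def by blast

lemma D_scale: "D u (\<lambda>x. c * w x) = c * D u w"
  unfolding D_def by (simp add: mult.left_commute form_scale_right)

text \<open>The difference quotients of F(v + s \<phi>) converge in l^1, and the bilinear form is
  continuous on l^1; the symmetry of the kernel merges the two terms of the product rule, cancelling
  the 1/2 in \<open>Phi\<close>.\<close>

lemma Phi_deriv:
  assumes v: "in_lp p v" and \<phi>: "in_lp p \<phi>"
  shows "((\<lambda>s. Phi (\<lambda>x. v x + s * \<phi> x)) has_real_derivative D (\<lambda>x. v x + s * \<phi> x) \<phi>) (at s)"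
  unfolding has_field_derivative_iff tendsto_at_iff_sequentially comp_def
proof (intro allI impI)
  fix X :: "nat \<Rightarrow> real" assume Xs: "\<forall>i. X i \<in> UNIV - {s}" and X: "X \<longlonglongrightarrow> s"
  have ne: "X n - s \<noteq> 0" for n using Xs by auto
  define a where "a n x = F (v x + X n * \<phi> x)" for n x
  define a0 where "a0 x = F (v x + s * \<phi> x)" for x
  define q where "q n x = (a n x - a0 x) / (X n - s)" for n x
  define q0 where "q0 x = f (v x + s * \<phi> x) * \<phi> x" for x
  have la: "l1_lim a a0" unfolding a_def a0_def
    using l1_lim_F[OF lp_lim_combine[OF v \<phi> tendsto_const[of 1] X]] by simp
  have sa: "a n summable_on UNIV" "a0 summable_on UNIV" for n using la unfolding l1_lim_def by auto
  have lq: "l1_lim q q0"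
  proof -
    obtain c1 where c1: "\<And>n. \<bar>X n\<bar> \<le> c1" using convergent_imp_Bseq[OF convergentI[OF X]] by (auto simp: Bseq_def)
    define c where "c = max 1 (max c1 \<bar>s\<bar>)"
    have c: "c \<ge> 1" "\<bar>s\<bar> \<le> c" "\<bar>X n\<bar> \<le> c" for n using c1[of n] unfolding c_def by auto
    \<comment> \<open>A single l^p function above |v + t \<phi>| for all |t| <= c and above
      |\<phi>|. The quotients are then dominated by C r^p.\<close>
    define r where "r x = c * (\<bar>v x\<bar> + \<bar>\<phi> x\<bar>)" for x
    have r0: "r x \<ge> 0" for x unfolding r_def using c by auto
    have r1: "\<bar>v x + t * \<phi> x\<bar> \<le> r x" if "\<bar>t\<bar> \<le> c" for t x
    proof -
      have "\<bar>v x + t * \<phi> x\<bar> \<le> 1 * \<bar>v x\<bar> + \<bar>t\<bar> * \<bar>\<phi> x\<bar>"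
        by (rule order_trans[OF abs_triangle_ineq]) (simp add: abs_mult)
      also have "\<dots> \<le> c * \<bar>v x\<bar> + c * \<bar>\<phi> x\<bar>" using that c by (intro add_mono mult_right_mono) auto
      finally show ?thesis unfolding r_def by (simp add: distrib_left)
    qed
    have r2: "\<bar>\<phi> x\<bar> \<le> r x" for x
    proof -
      have "\<bar>\<phi> x\<bar> \<le> 1 * (\<bar>v x\<bar> + \<bar>\<phi> x\<bar>)" by simp
      also have "\<dots> \<le> r x" unfolding r_def using c by (intro mult_right_mono) auto
      finally show ?thesis .
    qed
    have r: "in_lp p r" unfolding r_def using p2 by (intro in_lp_scale in_lp_add in_lp_abs v \<phi>) auto
    then obtain M where M: "\<And>x. \<bar>r x\<bar> \<le> M" using in_lp_bounded[of p r] p2 by auto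
    obtain C where C: "C > 0" "\<And>s. \<bar>s\<bar> \<le> M \<Longrightarrow> \<bar>f s\<bar> \<le> C * \<bar>s\<bar> powr (p - 1)"
      using f_growth[of M] by auto
    show ?thesis
    proof (rule l1_lim_tight)
      fix x
      have "((\<lambda>t. F (v x + t * \<phi> x)) has_real_derivative q0 x) (at s)"
        unfolding q0_def
        by (rule DERIV_chain2[OF primitive_deriv[OF cont]]) (auto intro!: derivative_eq_intros)
      then show "(\<lambda>n. q n x) \<longlonglongrightarrow> q0 x"
        using Xs X unfolding has_field_derivative_iff tendsto_at_iff_sequentially comp_def q_def a_def a0_def
        by blast
    next
      fix n x
      have "\<bar>a n x - a0 x\<bar> \<le> C * r x powr (p - 1) * \<bar>(v x + X n * \<phi> x) - (v x + s * \<phi> x)\<bar>"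
        unfolding a_def a0_def using M[of x] C p2
        by (intro primitive_diff_bound cont r1 c) auto
      also have "(v x + X n * \<phi> x) - (v x + s * \<phi> x) = (X n - s) * \<phi> x" by (simp add: algebra_simps)
      finally have "\<bar>q n x\<bar> \<le> C * r x powr (p - 1) * \<bar>\<phi> x\<bar>"
        using ne[of n] unfolding q_def by (simp add: abs_mult divide_le_eq mult_ac)
      also have "\<dots> \<le> C * r x powr (p - 1) * r x" using C r2 by (intro mult_left_mono) auto
      also have "\<dots> = C * \<bar>r x\<bar> powr p" using r0[of x] by (simp add: mult.assoc powr_mult_self)
      finally show "\<bar>q n x\<bar> \<le> C * \<bar>r x\<bar> powr p" .
    next
      show "tight (\<lambda>n x. C * \<bar>r x\<bar> powr p)"
        using r C(1) unfolding in_lp_def by (intro tight_const summable_on_cmult_right) auto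
    qed
  qed
  have sq: "q n summable_on UNIV" "q0 summable_on UNIV" for n using lq unfolding l1_lim_def by auto
  have eq: "(Phi (\<lambda>x. v x + X n * \<phi> x) - Phi (\<lambda>x. v x + s * \<phi> x)) / (X n - s)
     = (kernel_form (green \<alpha>) (q n) (a n) + kernel_form (green \<alpha>) a0 (q n)) / 2" for n
  proof -
    \<comment> \<open>The product rule in discrete form: change one argument of the bilinear form at
      a time.\<close>
    have d: "(\<lambda>x. a n x - a0 x) = (\<lambda>x. (X n - s) * q n x)" unfolding q_def using ne by auto
    have "kernel_form (green \<alpha>) (a n) (a n) - kernel_form (green \<alpha>) a0 a0
      = kernel_form (green \<alpha>) (\<lambda>x. a n x - a0 x) (a n) + kernel_form (green \<alpha>) a0 (\<lambda>x. a n x - a0 x)"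
      by (simp add: form_diff_left form_diff_right sa)
    also have "\<dots> = (X n - s) * (kernel_form (green \<alpha>) (q n) (a n) + kernel_form (green \<alpha>) a0 (q n))"
      unfolding d form_scale_left form_scale_right by (simp add: distrib_left)
    finally show ?thesis
      unfolding Phi_def using ne[of n] by (simp add: field_simps flip: a_def a0_def)
  qed
  have "(\<lambda>n. (kernel_form (green \<alpha>) (q n) (a n) + kernel_form (green \<alpha>) a0 (q n)) / 2)
     \<longlonglongrightarrow> (kernel_form (green \<alpha>) q0 a0 + kernel_form (green \<alpha>) a0 q0) / 2"
    by (intro tendsto_divide tendsto_add form_tendsto la lq l1_lim_const sa tendsto_const) auto
  also have "(kernel_form (green \<alpha>) q0 a0 + kernel_form (green \<alpha>) a0 q0) / 2 = D (\<lambda>x. v x + s * \<phi> x) \<phi>"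
    unfolding D_def using form_sym[OF sq(2) sa(2)] by (simp flip: a0_def[abs_def] q0_def)
  finally show "(\<lambda>n. (Phi (\<lambda>x. v x + X n * \<phi> x) - Phi (\<lambda>x. v x + s * \<phi> x)) / (X n - s)) \<longlonglongrightarrow>
      D (\<lambda>x. v x + s * \<phi> x) \<phi>"
    unfolding eq .
qed

lemma Phi_ray_deriv:
  assumes "in_lp p u"
  shows "((\<lambda>s. Phi (\<lambda>x. s * u x)) has_real_derivative D (\<lambda>x. s * u x) u) (at s)"
proof -
  have "in_lp p (\<lambda>x :: int ^ 'n. 0)" using in_lp_scale[OF assms, of 0] by simp
  from Phi_deriv[OF this assms] show ?thesis by simp
qed

lemma Phi_0: "Phi (\<lambda>x. 0) = 0"
  unfolding Phi_def kernel_form_def by (simp add: primitive_0)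

text \<open>Both arguments of the form are O(|u|^p) in l^1, so \<open>D u u\<close> is of order 2p
  while \<open>S u\<close> is of order p. This keeps the Nehari manifold away from 0.\<close>

lemma D_small:
  assumes u: "in_lp p u" and M: "\<And>x. \<bar>u x\<bar> \<le> M"
    and C: "C > 0" "\<And>s. \<bar>s\<bar> \<le> M \<Longrightarrow> \<bar>f s\<bar> \<le> C * \<bar>s\<bar> powr (p - 1) \<and> \<bar>F s\<bar> \<le> C * \<bar>s\<bar> powr p"
  shows "\<bar>D u u\<bar> \<le> B * C\<^sup>2 * (\<Sum>\<^sub>\<infinity>x. \<bar>u x\<bar> powr p)\<^sup>2"
proof -
  let ?P = "\<Sum>\<^sub>\<infinity>x. \<bar>u x\<bar> powr p"
  have s: "(\<lambda>x. C * \<bar>u x\<bar> powr p) summable_on UNIV"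
    using u unfolding in_lp_def by (rule summable_on_cmult_right)
  have 1: "(\<Sum>\<^sub>\<infinity>x. \<bar>F (u x)\<bar>) \<le> C * ?P"
    unfolding infsum_cmult_right'[symmetric]
    using C M by (intro infsum_mono summable_real_abs F_summable u s) auto
  have 2: "(\<Sum>\<^sub>\<infinity>x. \<bar>f (u x) * u x\<bar>) \<le> C * ?P"
    unfolding infsum_cmult_right'[symmetric]
  proof (intro infsum_mono summable_real_abs f_summable u s)
    fix x
    have "\<bar>f (u x) * u x\<bar> \<le> C * \<bar>u x\<bar> powr (p - 1) * \<bar>u x\<bar>"
      unfolding abs_mult using C M by (intro mult_right_mono) auto
    then show "\<bar>f (u x) * u x\<bar> \<le> C * \<bar>u x\<bar> powr p" by (simp add: mult.assoc powr_mult_self)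
  qed
  have "\<bar>D u u\<bar> \<le> B * (\<Sum>\<^sub>\<infinity>x. \<bar>F (u x)\<bar>) * (\<Sum>\<^sub>\<infinity>x. \<bar>f (u x) * u x\<bar>)"
    unfolding D_def by (rule form_bound[OF F_summable[OF u] f_summable[OF u u]])
  also have "\<dots> \<le> B * (C * ?P) * (C * ?P)"
    using 1 2 B_nonneg C by (intro mult_mono infsum_nonneg mult_nonneg_nonneg) auto
  finally show ?thesis by (simp add: power2_eq_square mult_ac)
qed

end

subsection \<open>The Nehari manifold\<close>

locale nehari_choquard = choquard +
  assumes mono: "u \<in> H \<Longrightarrow> u \<noteq> (\<lambda>_. 0) \<Longrightarrow>
    strict_mono_on {0<..} (\<lambda>t. D (\<lambda>x. t * u x) u / t powr p)"
begin

section \<open>The nonlocal term along rays\<close>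

definition "psi u t = D (\<lambda>x. t * u x) u / t powr p"

lemma D_ray: "t > 0 \<Longrightarrow> D (\<lambda>x. t * u x) u = t powr p * psi u t"
  unfolding psi_def by simp

lemma psi_mono: "u \<in> H \<Longrightarrow> u \<noteq> (\<lambda>_. 0) \<Longrightarrow> 0 < s \<Longrightarrow> s < t \<Longrightarrow> psi u s < psi u t"
  using strict_mono_onD[OF mono, of u s t] unfolding psi_def by simp

lemma psi_mono_le: "u \<in> H \<Longrightarrow> u \<noteq> (\<lambda>_. 0) \<Longrightarrow> 0 < s \<Longrightarrow> s \<le> t \<Longrightarrow> psi u s \<le> psi u t"
  using psi_mono[of u s t] by (cases "s = t") auto

text \<open>\<open>D_small\<close> at t u gives order t^(2p), while D (t u) (t u) = t t^p psi u t;
  the quotient leaves t^(p-1).\<close>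

lemma psi_bound:
  assumes "u \<in> H"
  shows "\<exists>K. \<forall>t. 0 < t \<longrightarrow> t \<le> 1 \<longrightarrow> \<bar>psi u t\<bar> \<le> K * t powr (p - 1)"
proof -
  have u: "in_lp p u" by (rule H_in_lp[OF assms])
  obtain M where M: "\<And>x. \<bar>u x\<bar> \<le> M" using in_lp_bounded[OF u] p2 by auto
  obtain C where C: "C > 0" "\<And>s. \<bar>s\<bar> \<le> M \<Longrightarrow> \<bar>f s\<bar> \<le> C * \<bar>s\<bar> powr (p - 1) \<and> \<bar>F s\<bar> \<le> C * \<bar>s\<bar> powr p"
    using F_growth[of M] by auto
  let ?P = "\<Sum>\<^sub>\<infinity>x. \<bar>u x\<bar> powr p"
  have "\<bar>psi u t\<bar> \<le> (B * C\<^sup>2 * ?P\<^sup>2) * t powr (p - 1)" if t: "0 < t" "t \<le> 1" for t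
  proof -
    let ?w = "\<lambda>x. t * u x"
    have "\<bar>?w x\<bar> \<le> M" for x
      using mult_mono[of t 1 "\<bar>u x\<bar>" M] M[of x] t by (simp add: abs_mult)
    then have "\<bar>D ?w ?w\<bar> \<le> B * C\<^sup>2 * (\<Sum>\<^sub>\<infinity>x. \<bar>?w x\<bar> powr p)\<^sup>2"
      by (intro D_small in_lp_scale u C)
    also have "(\<Sum>\<^sub>\<infinity>x. \<bar>?w x\<bar> powr p) = t powr p * ?P"
      using t by (simp add: abs_mult powr_mult infsum_cmult_right')
    also have "D ?w ?w = t * (t powr p * psi u t)" using t by (simp add: D_scale D_ray)
    finally have "t * t powr p * \<bar>psi u t\<bar> \<le> B * C\<^sup>2 * (t powr p * ?P)\<^sup>2"
      using t by (simp add: abs_mult mult.assoc)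
    also have "\<dots> = t * t powr p * ((B * C\<^sup>2 * ?P\<^sup>2) * t powr (p - 1))"
    proof -
      have tp: "t powr p = t powr (p - 1) * t" using powr_mult_self[of t p] t by simp
      show ?thesis unfolding tp by (simp only: power2_eq_square mult_ac)
    qed
    finally show ?thesis using t by (simp add: mult_le_cancel_left_pos)
  qed
  then show ?thesis by blast
qed

text \<open>Monotonicity and the limit 0 at the origin only give psi u (t/2) >= 0; the step from t/2
  to t makes it strict.\<close>

lemma psi_pos:
  assumes u: "u \<in> H" "u \<noteq> (\<lambda>_. 0)" and t: "t > 0" shows "psi u t > 0"
proof -
  obtain K where K: "\<And>t. 0 < t \<Longrightarrow> t \<le> 1 \<Longrightarrow> \<bar>psi u t\<bar> \<le> K * t powr (p - 1)"
    using psi_bound[OF u(1)] by auto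
  have "((\<lambda>s::real. - (K * \<bar>s\<bar> powr (p - 1))) \<longlongrightarrow> - (K * \<bar>0\<bar> powr (p - 1))) (at_right 0)"
    using p2 by (intro tendsto_minus tendsto_mult tendsto_const tendsto_abs_powr tendsto_ident_at) auto
  then have "- (K * \<bar>0\<bar> powr (p - 1)) \<le> psi u (t / 2)"
  proof (rule tendsto_upperbound)
    have "eventually (\<lambda>s. s \<in> {0<..<min 1 (t/2)}) (at_right 0)"
      using t by (intro eventually_at_right_real) auto
    then show "eventually (\<lambda>s. - (K * \<bar>s\<bar> powr (p - 1)) \<le> psi u (t / 2)) (at_right 0)"
    proof eventually_elim
      case (elim s)
      then have "psi u s < psi u (t/2)" by (intro psi_mono u) auto
      then show ?case using K[of s] elim by auto
    qed
  qed simp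
  also have "psi u (t/2) < psi u t" using t by (intro psi_mono u) auto
  finally show ?thesis by simp
qed

lemma S_zero: "S (\<lambda>x. 0) = 0"
  using S_scale[of 0 "\<lambda>x. 0"] p2 by simp

text \<open>Obtained by integrating \<open>d/ds Phi (s u) = s\<^sup>p psi u s\<close> over \<open>[0, 1]\<close>; no sign of the
  kernel is used.\<close>

lemma Phi_le_D:
  assumes u: "u \<in> H" "u \<noteq> (\<lambda>_. 0)" shows "(p + 1) * Phi u \<le> D u u"
proof -
  let ?k = "\<lambda>s. psi u 1 / (p + 1) * s powr (p + 1) - Phi (\<lambda>x. s * u x)"
  have lp: "in_lp p u" by (rule H_in_lp[OF u(1)])
  have "?k 0 \<le> ?k 1"
  proof (rule DERIV_nonneg_imp_increasing_open[of 0 1 ?k])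
    fix s :: real assume s: "0 < s" "s < 1"
    have der: "(?k has_real_derivative psi u 1 / (p + 1) * ((p + 1) * s powr (p + 1 - 1)) - D (\<lambda>x. s * u x) u) (at s)"
      using s by (intro DERIV_diff DERIV_cmult has_real_derivative_powr Phi_ray_deriv lp)
    have eq: "psi u 1 / (p + 1) * ((p + 1) * s powr (p + 1 - 1)) - D (\<lambda>x. s * u x) u
        = s powr p * (psi u 1 - psi u s)"
      using p2 s by (simp add: D_ray right_diff_distrib)
    have "s powr p * (psi u 1 - psi u s) \<ge> 0" using psi_mono[OF u, of s 1] s by simp
    then show "\<exists>y. (?k has_real_derivative y) (at s) \<and> y \<ge> 0" using der unfolding eq by blast
  next
    have "continuous_on {0..1} (\<lambda>s. Phi (\<lambda>x. s * u x))"
      by (rule DERIV_continuous_on[OF has_field_derivative_at_within[OF Phi_ray_deriv[OF lp]]])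
    moreover have "continuous_on {0..1} (\<lambda>s::real. s powr (p + 1))"
      using p2 by (intro continuous_on_powr' continuous_on_id continuous_on_const) auto
    ultimately show "continuous_on {0..1} ?k" by (intro continuous_on_diff continuous_on_mult_left)
  qed simp
  then show ?thesis using p2 by (simp add: Phi_0 psi_def field_simps)
qed

text \<open>\<open>D u u\<close> stands where \<open>J\<close> has \<open>S u\<close>: the two agree
  on the manifold, but the limit of a minimizing sequence is only known to satisfy S w <= D w w. The
  derivative along the ray is s^(p-1) (psi u 1 - s psi u s), and s psi u s is increasing, so the
  sign changes from plus to minus at s = 1.\<close>

lemma ray_max:
  assumes u: "u \<in> H" "u \<noteq> (\<lambda>_. 0)" and t: "t > 0"
  shows "t powr p / p * D u u - Phi (\<lambda>x. t * u x) \<le> D u u / p - Phi u"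
proof -
  let ?k = "\<lambda>s. D u u / p * s powr p - Phi (\<lambda>x. s * u x)"
  have lp: "in_lp p u" by (rule H_in_lp[OF u(1)])
  have D1: "D u u = psi u 1" by (simp add: psi_def)
  have der: "(?k has_real_derivative s powr (p - 1) * (psi u 1 - s * psi u s)) (at s)" if s: "0 < s" for s
  proof -
    have "(?k has_real_derivative D u u / p * (p * s powr (p - 1)) - D (\<lambda>x. s * u x) u) (at s)"
      using s by (intro DERIV_diff DERIV_cmult has_real_derivative_powr Phi_ray_deriv lp)
    moreover have "D u u / p * (p * s powr (p - 1)) - D (\<lambda>x. s * u x) u = s powr (p - 1) * (psi u 1 - s * psi u s)"
      using p2 s powr_mult_self[of s p] by (simp add: D_ray D1 right_diff_distrib mult.assoc[symmetric])
    ultimately show ?thesis by simp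
  qed
  have "?k t \<le> ?k 1"
  proof (cases "t \<le> 1")
    case True
    show ?thesis
    proof (rule DERIV_nonneg_imp_nondecreasing[OF True])
      fix s assume s: "t \<le> s" "s \<le> 1"
      have "s * psi u s \<le> 1 * psi u 1"
        using s t psi_pos[OF u, of s] psi_mono_le[OF u, of s 1] by (intro mult_mono) auto
      then show "\<exists>y. (?k has_real_derivative y) (at s) \<and> y \<ge> 0"
        using der[of s] s t by (intro exI conjI) (auto intro!: mult_nonneg_nonneg)
    qed
  next
    case False
    show ?thesis
    proof (rule DERIV_nonpos_imp_nonincreasing[of 1 t ?k])
      show "1 \<le> t" using False by simp
      fix s assume s: "1 \<le> s" "s \<le> t"
      have "1 * psi u 1 \<le> s * psi u s"
        using s t psi_pos[OF u, of 1] psi_mono_le[OF u, of 1 s] by (intro mult_mono) auto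
      then show "\<exists>y. (?k has_real_derivative y) (at s) \<and> y \<le> 0"
        using der[of s] s t by (intro exI conjI) (auto intro!: mult_nonneg_nonpos)
    qed
  qed
  then show ?thesis by (simp add: mult.commute)
qed

section \<open>The Nehari manifold and the energy on it\<close>

abbreviation "N \<equiv> nehari p \<alpha> h f"
abbreviation "J \<equiv> energy p \<alpha> h f"

lemma nehari_iff: "v \<in> N \<longleftrightarrow> v \<in> H \<and> v \<noteq> (\<lambda>_. 0) \<and> S v = D v v"
  unfolding nehari_def by (auto simp: energy_deriv_eq Nd_self)

lemma scale_nehari_iff:
  assumes u: "u \<in> H" "u \<noteq> (\<lambda>_. 0)" and t: "t > 0"
  shows "(\<lambda>x. t * u x) \<in> N \<longleftrightarrow> S u = t * psi u t"
proof -
  have "(\<lambda>x. t * u x) \<noteq> (\<lambda>_. 0)" using u(2) t by (metis mult_eq_0_iff less_irrefl)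
  moreover have "D (\<lambda>x. t * u x) (\<lambda>x. t * u x) = t powr p * (t * psi u t)"
    using t by (simp add: D_scale D_ray)
  moreover have "S (\<lambda>x. t * u x) = t powr p * S u" using t by (simp add: S_scale)
  ultimately show ?thesis unfolding nehari_iff using H_scale[OF u(1)] t by auto
qed

lemma scale_between:
  assumes u: "u \<in> H" "u \<noteq> (\<lambda>_. 0)" and a: "0 < a" "a \<le> b"
    and le: "a * psi u a \<le> S u" "S u \<le> b * psi u b"
  shows "\<exists>t. a \<le> t \<and> t \<le> b \<and> (\<lambda>x. t * u x) \<in> N"
proof -
  have "continuous_on {a..b} (\<lambda>t. D (\<lambda>x. t * u x) u)"
    by (rule continuous_on_sequentiallyI)
       (intro D_tendsto lp_lim_scale lp_lim_const H_in_lp u)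
  then have "continuous_on {a..b} (\<lambda>t. t * psi u t)"
    unfolding psi_def using a by (intro continuous_intros) auto
  from IVT'[of "\<lambda>t. t * psi u t", OF le a(2) this] obtain t where "a \<le> t" "t \<le> b" "t * psi u t = S u"
    by blast
  then show ?thesis using scale_nehari_iff[OF u, of t] a by (intro exI[of _ t]) auto
qed

lemma scale_below:
  assumes u: "u \<in> H" "u \<noteq> (\<lambda>_. 0)" and b: "b > 0" "S u \<le> b * psi u b"
  shows "\<exists>t. 0 < t \<and> t \<le> b \<and> (\<lambda>x. t * u x) \<in> N"
proof -
  \<comment> \<open>For a <= b monotonicity gives a psi u a <= a psi u b, so a = S u / psi u b is
    already small enough for the lower end of the bracket.\<close>
  define a where "a = min b (S u / psi u b)"
  have a: "0 < a" "a \<le> b" unfolding a_def using b S_pos[OF u] psi_pos[OF u b(1)] by auto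
  have "a * psi u a \<le> a * psi u b" using a by (intro mult_left_mono psi_mono_le u) auto
  also have "\<dots> \<le> S u / psi u b * psi u b"
    using psi_pos[OF u b(1)] by (intro mult_right_mono) (auto simp: a_def)
  also have "\<dots> = S u" using psi_pos[OF u b(1)] by simp
  finally obtain t where "a \<le> t" "t \<le> b" "(\<lambda>x. t * u x) \<in> N" using scale_between[OF u a _ b(2)] by blast
  then show ?thesis using a by (intro exI[of _ t]) auto
qed

lemma delta_H: "(\<lambda>z. if z = x then 1 else 0) \<in> H"
  unfolding H_iff by (rule finite_nonzero_values_imp_summable_on) (rule finite_subset[of _ "{x}"], auto)

lemma nehari_nonempty: "N \<noteq> {}"
proof -
  let ?d = "\<lambda>z :: int ^ 'a. if z = 0 then 1 else (0 :: real)"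
  have d: "?d \<in> H" "?d \<noteq> (\<lambda>_. 0)" using delta_H[of 0] by (auto dest: fun_cong[of _ _ 0])
  \<comment> \<open>For b >= 1 the value b psi u b is at least b psi u 1, hence it reaches S as soon
    as b >= S / psi u 1.\<close>
  define b where "b = max 1 (S ?d / psi ?d 1)"
  have pos: "psi ?d 1 > 0" by (rule psi_pos[OF d]) simp
  have "S ?d = S ?d / psi ?d 1 * psi ?d 1" using pos by simp
  also have "\<dots> \<le> b * psi ?d b"
    using pos psi_mono_le[OF d, of 1 b] unfolding b_def by (intro mult_mono) auto
  finally show ?thesis using scale_below[OF d, of b] unfolding b_def by fastforce
qed

lemma J_lower:
  assumes "v \<in> N" shows "S v / (p * (p + 1)) \<le> J v"
proof -
  have v: "v \<in> H" "v \<noteq> (\<lambda>_. 0)" "S v = D v v" using assms unfolding nehari_iff by auto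
  have "Phi v \<le> S v / (p + 1)" using Phi_le_D[OF v(1,2)] v(3) p2 by (simp add: field_simps)
  moreover have "S v / p - S v / (p + 1) = S v / (p * (p + 1))" using p2 by (simp add: field_simps)
  ultimately show ?thesis unfolding energy_eq by linarith
qed

text \<open>On the manifold S v = D v v <= A (S v / h0)^2 with A = B C^2, and one factor S v > 0
  cancels.\<close>

lemma nehari_lower: "\<exists>c>0. \<forall>v\<in>N. c \<le> S v"
proof -
  obtain C where C: "C > 0" "\<And>s. \<bar>s\<bar> \<le> (1 / h\<^sub>0) powr (1/p) \<Longrightarrow>
      \<bar>f s\<bar> \<le> C * \<bar>s\<bar> powr (p - 1) \<and> \<bar>F s\<bar> \<le> C * \<bar>s\<bar> powr p"
    using F_growth by blast
  let ?A = "B * C\<^sup>2"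
  have A: "?A \<ge> 0" using B_nonneg by simp
  \<comment> \<open>The constant C is valid only under the pointwise bound that follows from S v <=
    1, hence the minimum with 1. The summand 1 in the denominator avoids division by 0.\<close>
  define c where "c = min 1 (h\<^sub>0\<^sup>2 / (?A + 1))"
  have c0: "c > 0" unfolding c_def using h0 A by simp
  have "c \<le> S v" if "v \<in> N" for v
  proof (cases "S v \<le> 1")
    case True
    have v: "v \<in> H" "v \<noteq> (\<lambda>_. 0)" "S v = D v v" using that unfolding nehari_iff by auto
    let ?P = "\<Sum>\<^sub>\<infinity>x. \<bar>v x\<bar> powr p"
    have "?P \<ge> 0" by (intro infsum_nonneg) simp
    then have P: "0 \<le> h\<^sub>0 * ?P" "h\<^sub>0 * ?P \<le> S v"
      using sum_powr_le_S(2)[OF v(1)] h0 by auto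
    have "S v \<le> ?A * ?P\<^sup>2"
      using D_small[OF H_in_lp[OF v(1)] pointwise_bound[OF v(1) True] C] v(3) by auto
    then have "h\<^sub>0\<^sup>2 * S v \<le> ?A * (h\<^sub>0 * ?P)\<^sup>2"
      using h0 mult_left_mono[of "S v" "?A * ?P\<^sup>2" "h\<^sub>0\<^sup>2"] by (simp add: power_mult_distrib mult_ac)
    also have "\<dots> \<le> (?A + 1) * (S v)\<^sup>2"
      using A P by (intro mult_mono power_mono) auto
    finally have "h\<^sub>0\<^sup>2 \<le> (?A + 1) * S v"
      using S_pos[OF v(1,2)] by (simp add: power2_eq_square mult.assoc[symmetric])
    then have "h\<^sub>0\<^sup>2 / (?A + 1) \<le> S v" using A by (simp add: divide_le_eq mult.commute)
    then show ?thesis unfolding c_def by simp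
  qed (simp add: c_def)
  then show ?thesis using c0 by blast
qed

lemma nehari_ray_max:
  assumes "v \<in> N" "t > 0" shows "J (\<lambda>x. t * v x) \<le> J v"
proof -
  have v: "v \<in> H" "v \<noteq> (\<lambda>_. 0)" "S v = D v v" using assms unfolding nehari_iff by auto
  show ?thesis using ray_max[OF v(1,2) assms(2)] assms(2) unfolding energy_eq by (simp add: S_scale v(3))
qed

text \<open>Finiteness of the sublevel sets of \<open>h\<close> turns a bound on the weighted norm into tightness.\<close>

lemma compact_embedding:
  assumes v: "\<And>n. v n \<in> H" and K: "\<And>n. S (v n) \<le> K"
  obtains k w where "strict_mono (k :: nat \<Rightarrow> nat)" "lp_lim (\<lambda>n. v (k n)) w"
proof -
  have M: "\<bar>v n x\<bar> \<le> (K / h\<^sub>0) powr (1/p)" for n x by (rule pointwise_bound[OF v K])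
  obtain k where k: "strict_mono (k :: nat \<Rightarrow> nat)" "\<And>x. \<exists>l. (\<lambda>n. v (k n) x) \<longlonglongrightarrow> l"
    using function_convergent_subsequence[of UNIV v "(K / h\<^sub>0) powr (1/p)"] M by auto
  then obtain w where w: "\<And>x. (\<lambda>n. v (k n) x) \<longlonglongrightarrow> w x" by metis
  have K0: "K \<ge> 0" using S_nonneg[of "v 0"] K[of 0] by linarith
  have "tight (\<lambda>n x. \<bar>v (k n) x\<bar> powr p)"
    unfolding tight_def
  proof (intro allI impI)
    fix e :: real assume e: "e > 0"
    define Z where "Z = (K + 1) / e"
    have Z: "Z > 0" unfolding Z_def using K0 e by simp
    show "\<exists>A. finite A \<and> (\<forall>n E. finite E \<longrightarrow> E \<inter> A = {} \<longrightarrow> (\<Sum>x\<in>E. \<bar>v (k n) x\<bar> powr p) \<le> e)"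
    proof (intro exI[of _ "{x. h x < Z}"] conjI allI impI sublevel)
      fix n E assume E: "finite E" "E \<inter> {x. h x < Z} = {}"
      have "Z * (\<Sum>x\<in>E. \<bar>v (k n) x\<bar> powr p) \<le> (\<Sum>x\<in>E. T (v (k n)) x)"
        unfolding sum_distrib_left
      proof (intro sum_mono)
        fix x assume "x \<in> E"
        then have "Z \<le> h x" using E by force
        then have "Z * \<bar>v (k n) x\<bar> powr p \<le> h x * \<bar>v (k n) x\<bar> powr p" by (intro mult_right_mono) auto
        then show "Z * \<bar>v (k n) x\<bar> powr p \<le> T (v (k n)) x" unfolding T_def by (simp add: add_increasing)
      qed
      also have "\<dots> \<le> S (v (k n))" unfolding S_def
        using E by (intro finite_sum_le_infsum T_summable v T_nonneg) auto
      also have "\<dots> \<le> K" by (rule K)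
      also have "\<dots> \<le> Z * e" unfolding Z_def using e by simp
      finally show "(\<Sum>x\<in>E. \<bar>v (k n) x\<bar> powr p) \<le> e" using Z by (simp add: mult_le_cancel_left_pos)
    qed
  qed
  then have "lp_lim (\<lambda>n. v (k n)) w" unfolding lp_lim_def using w M by blast
  then show ?thesis using that k(1) by blast
qed

text \<open>Fatou's lemma for counting measure: a finite partial sum of \<open>T\<close> involves
  finitely many values of \<open>v n\<close> and passes to the limit. That all partial sums for w
  stay below L also puts w into \<open>H\<close>.\<close>

lemma S_Fatou:
  assumes v: "\<And>n. v n \<in> H" and w: "\<And>x. (\<lambda>n. v n x) \<longlonglongrightarrow> w x" and L: "(\<lambda>n. S (v n)) \<longlonglongrightarrow> L"
  shows "w \<in> H \<and> S w \<le> L"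
proof -
  have fin: "sum (T w) A \<le> L" if "finite A" for A
  proof (rule tendsto_le[OF _ L])
    have "(\<lambda>n. \<bar>grad_norm (v n) x\<bar> powr p) \<longlonglongrightarrow> \<bar>grad_norm w x\<bar> powr p" for x
      using p2 by (intro tendsto_abs_powr tendsto_grad_norm w) auto
    then have "(\<lambda>n. T (v n) x) \<longlonglongrightarrow> T w x" for x
      unfolding T_def using p2
      by (intro tendsto_add tendsto_mult[OF tendsto_const] tendsto_abs_powr w) (auto simp: grad_norm_nonneg)
    then show "(\<lambda>n. sum (T (v n)) A) \<longlonglongrightarrow> sum (T w) A" by (intro tendsto_sum)
    show "eventually (\<lambda>n. sum (T (v n)) A \<le> S (v n)) sequentially"
      unfolding S_def using that by (intro always_eventually allI finite_sum_le_infsum T_summable v T_nonneg) auto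
  qed simp
  have "T w summable_on UNIV"
    by (rule nonneg_bdd_above_summable_on) (use fin T_nonneg in \<open>auto intro!: bdd_aboveI\<close>)
  then show ?thesis
    using T_summable_imp_H[of w] infsum_le_finite_sums[of "T w" UNIV L] fin unfolding S_def by auto
qed

lemma minimizer: "\<exists>w\<in>N. \<forall>v\<in>N. J w \<le> J v"
proof -
  define m where "m = Inf (J ` N)"
  have J0: "J v \<ge> 0" if "v \<in> N" for v
    using order_trans[OF _ J_lower[OF that]] S_nonneg[of v] p2 by simp
  then have bdd: "bdd_below (J ` N)" by (intro bdd_belowI[of _ 0]) auto
  have m_le: "m \<le> J v" if "v \<in> N" for v unfolding m_def using bdd that by (intro cInf_lower) auto
  have "\<exists>v\<in>N. J v < m + 1 / real (Suc n)" for n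
    using cInf_lessD[of "J ` N" "m + 1 / real (Suc n)"] nehari_nonempty unfolding m_def by auto
  then obtain v where v: "\<And>n. v n \<in> N" "\<And>n. J (v n) < m + 1 / real (Suc n)" by metis
  have vH: "v n \<in> H" "v n \<noteq> (\<lambda>_. 0)" "S (v n) = D (v n) (v n)" for n using v(1)[of n] unfolding nehari_iff by auto
  have SK: "S (v n) \<le> p * (p + 1) * (m + 1)" for n
  proof -
    have "1 / real (Suc n) \<le> 1" by simp
    then have "S (v n) / (p * (p + 1)) \<le> m + 1" using J_lower[OF v(1)[of n]] v(2)[of n] by linarith
    then show ?thesis using p2 by (simp add: divide_le_eq mult.commute)
  qed
  obtain k w where k: "strict_mono (k :: nat \<Rightarrow> nat)" and lim: "lp_lim (\<lambda>n. v (k n)) w"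
    by (rule compact_embedding[OF vH(1) SK])
  have DL: "(\<lambda>n. D (v (k n)) (v (k n))) \<longlonglongrightarrow> D w w" by (rule D_tendsto[OF lim lim])
  \<comment> \<open>Membership in the manifold replaces S by the nonlocal term, which converges; the
    limit is \<open>D w w\<close> and may exceed \<open>S w\<close>.\<close>
  then have SL: "(\<lambda>n. S (v (k n))) \<longlonglongrightarrow> D w w" using vH(3) by simp
  have w: "w \<in> H" "S w \<le> D w w" using S_Fatou[OF vH(1) _ SL] lim unfolding lp_lim_def by auto
  obtain c where c: "c > 0" "\<And>v. v \<in> N \<Longrightarrow> c \<le> S v" using nehari_lower by auto
  \<comment> \<open>The lower bound on the manifold survives in \<open>D w w\<close>, which would
    vanish for w = 0.\<close>
  have Dc: "D w w \<ge> c" by (rule tendsto_lowerbound[OF SL]) (use c v in auto)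
  have w0: "w \<noteq> (\<lambda>_. 0)"
  proof
    assume "w = (\<lambda>_. 0)"
    then have "D w w = 0" using D_scale[of w 0 w] by simp
    then show False using Dc c by simp
  qed
  have Jlim: "(\<lambda>n. J (v (k n))) \<longlonglongrightarrow> D w w / p - Phi w"
    unfolding energy_eq using p2 by (intro tendsto_diff tendsto_divide SL Phi_tendsto[OF lim] tendsto_const) auto
  have Jm: "(\<lambda>n. J (v n)) \<longlonglongrightarrow> m"
  proof (rule tendsto_sandwich[of "\<lambda>_. m" _ _ "\<lambda>n. m + 1 / real (Suc n)"])
    show "(\<lambda>n. m + 1 / real (Suc n)) \<longlonglongrightarrow> m"
      using tendsto_add[OF tendsto_const[of m] LIMSEQ_inverse_real_of_nat] by (simp add: inverse_eq_divide)
  qed (simp_all add: m_le v(1) less_imp_le[OF v(2)] del: of_nat_Suc)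
  have eq: "D w w / p - Phi w = m"
    by (rule LIMSEQ_unique[OF Jlim LIMSEQ_subseq_LIMSEQ[OF Jm k, unfolded comp_def]])
  \<comment> \<open>Since S w <= 1 psi w 1, the ray through w meets the manifold at some t <= 1.
    There the energy is at most the modified energy of t w, which \<open>ray_max\<close> bounds by
    m.\<close>
  have "D w w = psi w 1" by (simp add: psi_def)
  then obtain t where t: "0 < t" "t \<le> 1" "(\<lambda>x. t * w x) \<in> N"
    using scale_below[OF w(1) w0, of 1] w(2) by auto
  have "J (\<lambda>x. t * w x) = t powr p * S w / p - Phi (\<lambda>x. t * w x)"
    unfolding energy_eq S_scale using t(1) by simp
  also have "\<dots> \<le> t powr p / p * D w w - Phi (\<lambda>x. t * w x)"
    using w(2) p2 mult_left_mono[OF w(2), of "t powr p / p"] by simp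
  also have "\<dots> \<le> m" using ray_max[OF w(1) w0 t(1)] eq by simp
  finally show ?thesis using m_le t(3) by (meson order_trans)
qed

end

subsection \<open>Minimizers are critical points\<close>

context nehari_choquard
begin

text \<open>The intermediate value theorem takes the place of an implicit function theorem: at w the
  scales 1 - e/2 and 1 + e/2 bracket the root strictly, and strict inequalities persist for w + s
  \<phi> with s small.\<close>

lemma nearby_nehari:
  assumes w: "w \<in> N" and \<phi>: "\<phi> \<in> H" and e: "0 < e" "e < 1"
  shows "\<exists>t \<sigma>. \<bar>t - 1\<bar> \<le> e \<and> 0 < \<sigma> \<and> \<sigma> \<le> e \<and> (\<lambda>x. t * w x + \<sigma> * \<phi> x) \<in> N"
proof -
  have wH: "w \<in> H" "w \<noteq> (\<lambda>_. 0)" "S w = D w w" using w unfolding nehari_iff by auto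
  have psi1: "psi w 1 = S w" by (simp add: psi_def wH(3))
  define s where "s n = 1 / real (Suc n)" for n
  have s: "s \<longlonglongrightarrow> 0" unfolding s_def using LIMSEQ_inverse_real_of_nat by (simp add: inverse_eq_divide)
  have s0: "s n > 0" for n unfolding s_def by simp
  define W where "W n x = 1 * w x + s n * \<phi> x" for n x
  have WH: "W n \<in> H" for n unfolding W_def by (rule H_combine[OF wH(1) \<phi>])
  have lp: "in_lp p w" "in_lp p \<phi>" by (rule H_in_lp wH \<phi>)+
  have lW: "lp_lim W w"
    unfolding W_def using lp_lim_combine[OF lp tendsto_const[of 1] s] by simp
  have tW: "lp_lim (\<lambda>n x. c * W n x) (\<lambda>x. c * w x)" for c
    unfolding W_def
    using lp_lim_combine[OF lp tendsto_const[of c] tendsto_mult[OF tendsto_const[of c] s]]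
    by (simp add: distrib_left mult.assoc)
  have psiL: "(\<lambda>n. c * psi (W n) c) \<longlonglongrightarrow> c * psi w c" if "c > 0" for c
    unfolding psi_def using that by (intro tendsto_intros D_tendsto tW lW) auto
  have SL: "(\<lambda>n. S (W n)) \<longlonglongrightarrow> S w"
  proof -
    \<comment> \<open>Continuity of S along \<open>W n\<close>, read off from S(W) = Nd W W = Nd W w
      + s Nd W \<phi>.\<close>
    have "(\<lambda>n. 1 * Nd (W n) w + s n * Nd (W n) \<phi>) \<longlonglongrightarrow> 1 * Nd (\<lambda>x. 1 * w x + 0 * \<phi> x) w + 0 * Nd (\<lambda>x. 1 * w x + 0 * \<phi> x) \<phi>"
      unfolding W_def by (intro tendsto_add tendsto_mult Nd_tendsto wH \<phi> s tendsto_const)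
    moreover have "1 * Nd (W n) w + s n * Nd (W n) \<phi> = S (W n)" for n
    proof -
      have "(\<lambda>x. 1 * w x + s n * \<phi> x) = W n" by (simp add: W_def fun_eq_iff)
      then show ?thesis using Nd_combine[OF WH wH(1) \<phi>, of n 1 "s n"] Nd_self[of "W n"] by metis
    qed
    ultimately show ?thesis by (simp add: Nd_self)
  qed
  have lo: "(1 - e/2) * psi w (1 - e/2) < S w"
  proof -
    have "(1 - e/2) * psi w (1 - e/2) < 1 * psi w 1"
      using e psi_mono[OF wH(1,2), of "1 - e/2" 1] psi_pos[OF wH(1,2), of "1 - e/2"]
      by (intro mult_strict_mono) auto
    then show ?thesis by (simp add: psi1)
  qed
  have hi: "S w < (1 + e/2) * psi w (1 + e/2)"
  proof -
    have "1 * psi w 1 < (1 + e/2) * psi w (1 + e/2)"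
      using e psi_mono[OF wH(1,2), of 1 "1 + e/2"] psi_pos[OF wH(1,2), of 1]
      by (intro mult_strict_mono) auto
    then show ?thesis by (simp add: psi1)
  qed
  have "eventually (\<lambda>n. S (W n) - (1 - e/2) * psi (W n) (1 - e/2) > 0) sequentially"
    using lo e by (intro order_tendstoD(1)[OF tendsto_diff[OF SL psiL]]) auto
  moreover have "eventually (\<lambda>n. (1 + e/2) * psi (W n) (1 + e/2) - S (W n) > 0) sequentially"
    using hi e by (intro order_tendstoD(1)[OF tendsto_diff[OF psiL SL]]) auto
  moreover have "eventually (\<lambda>n. S (W n) > 0) sequentially"
    by (rule order_tendstoD(1)[OF SL S_pos[OF wH(1,2)]])
  moreover have "eventually (\<lambda>n. s n < e / 2) sequentially"
    using e by (intro order_tendstoD(2)[OF s]) auto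
  ultimately have "eventually (\<lambda>n. (1 - e/2) * psi (W n) (1 - e/2) \<le> S (W n) \<and>
      S (W n) \<le> (1 + e/2) * psi (W n) (1 + e/2) \<and> S (W n) > 0 \<and> s n < e / 2) sequentially"
    by eventually_elim auto
  then obtain n where n: "(1 - e/2) * psi (W n) (1 - e/2) \<le> S (W n)"
      "S (W n) \<le> (1 + e/2) * psi (W n) (1 + e/2)" "S (W n) > 0" "s n < e / 2"
    unfolding eventually_sequentially by auto
  have "W n \<noteq> (\<lambda>_. 0)" using n(3) S_zero by auto
  from scale_between[OF WH this _ _ n(1,2)] e
  obtain t where t: "1 - e/2 \<le> t" "t \<le> 1 + e/2" "(\<lambda>x. t * W n x) \<in> N" by auto
  \<comment> \<open>With \<sigma> = t s n, the bounds t <= 2 and s n < e/2 give \<sigma> <=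
    e.\<close>
  have "t * s n \<le> 2 * (e / 2)" using t e n s0[of n] by (intro mult_mono) auto
  then show ?thesis
    using t e s0[of n]
    by (intro exI[of _ t] exI[of _ "t * s n"]) (auto simp: W_def distrib_left mult.assoc abs_le_iff)
qed

text \<open>Nothing is known about how fast t tends to 1 compared with \<sigma>. Comparing z = t w +
  \<sigma> \<phi> with t w instead of w leaves exactly the increment \<sigma> \<phi>, so only the
  limits of t and \<sigma> matter; J (t w) <= J w because w maximizes the energy on its own
  ray.\<close>

lemma minimizer_deriv_nonneg:
  assumes w: "w \<in> N" and min: "\<And>v. v \<in> N \<Longrightarrow> J w \<le> J v" and \<phi>: "\<phi> \<in> H"
  shows "Nd w \<phi> - D w \<phi> \<ge> 0"
proof -
  have wH: "w \<in> H" "w \<noteq> (\<lambda>_. 0)" using w unfolding nehari_iff by auto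
  have lp: "in_lp p w" "in_lp p \<phi>" by (rule H_in_lp wH \<phi>)+
  define e where "e n = 1 / real (Suc (Suc n))" for n
  have "(\<lambda>n. 1 / real (Suc n)) \<longlonglongrightarrow> 0" using LIMSEQ_inverse_real_of_nat by (simp add: inverse_eq_divide)
  then have e: "e \<longlonglongrightarrow> 0" unfolding e_def by (rule LIMSEQ_Suc)
  have e01: "0 < e n" "e n < 1" for n unfolding e_def by auto
  have "\<exists>t \<sigma>. \<bar>t - 1\<bar> \<le> e n \<and> 0 < \<sigma> \<and> \<sigma> \<le> e n \<and> (\<lambda>x. t * w x + \<sigma> * \<phi> x) \<in> N" for n
    by (rule nearby_nehari[OF w \<phi> e01])
  then obtain t \<sigma> where t: "\<And>n. \<bar>t n - 1\<bar> \<le> e n" and \<sigma>: "\<And>n. 0 < \<sigma> n" "\<And>n. \<sigma> n \<le> e n"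
    and N: "\<And>n. (\<lambda>x. t n * w x + \<sigma> n * \<phi> x) \<in> N" by metis
  define z where "z n x = t n * w x + \<sigma> n * \<phi> x" for n x
  have tpos: "t n > 0" for n using t[of n] e01[of n] by linarith
  have tlim: "t \<longlonglongrightarrow> 1"
  proof -
    have "(\<lambda>n. t n - 1) \<longlonglongrightarrow> 0"
      by (rule tendsto_rabs_zero_cancel, rule tendsto_sandwich[OF _ _ tendsto_const e]) (auto simp: t)
    then show ?thesis by (simp add: LIM_zero_iff)
  qed
  have \<sigma>lim: "\<sigma> \<longlonglongrightarrow> 0"
    by (rule tendsto_sandwich[OF _ _ tendsto_const e]) (auto simp: \<sigma> less_imp_le)
  have "\<exists>\<xi>. 0 < \<xi> \<and> \<xi> < \<sigma> n \<and>
      Phi (z n) - Phi (\<lambda>x. t n * w x) = \<sigma> n * D (\<lambda>x. t n * w x + \<xi> * \<phi> x) \<phi>" for n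
    using MVT2[OF \<sigma>(1)[of n], of "\<lambda>s. Phi (\<lambda>x. t n * w x + s * \<phi> x)" "\<lambda>s. D (\<lambda>x. t n * w x + s * \<phi> x) \<phi>"]
      Phi_deriv[OF in_lp_scale[OF lp(1)] lp(2)] by (auto simp: z_def[abs_def])
  then obtain \<xi> where \<xi>: "\<And>n. 0 < \<xi> n" "\<And>n. \<xi> n < \<sigma> n"
     and Phi: "\<And>n. Phi (z n) - Phi (\<lambda>x. t n * w x) = \<sigma> n * D (\<lambda>x. t n * w x + \<xi> n * \<phi> x) \<phi>" by metis
  have \<xi>lim: "\<xi> \<longlonglongrightarrow> 0"
    by (rule tendsto_sandwich[OF _ _ tendsto_const \<sigma>lim]) (auto simp: \<xi> less_imp_le)
  have nonneg: "0 \<le> Nd (z n) \<phi> - D (\<lambda>x. t n * w x + \<xi> n * \<phi> x) \<phi>" for n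
  proof -
    let ?y = "\<lambda>x. t n * w x"
    have zH: "z n \<in> H" unfolding z_def by (rule H_combine[OF wH(1) \<phi>])
    have yH: "?y \<in> H" by (rule H_scale[OF wH(1)])
    have "Nd (z n) ?y = t n * Nd (z n) w" using Nd_combine[OF zH wH(1) \<phi>, of "t n" 0] by simp
    moreover have "S (z n) = t n * Nd (z n) w + \<sigma> n * Nd (z n) \<phi>"
      using Nd_combine[OF zH wH(1) \<phi>, of "t n" "\<sigma> n"] Nd_self[of "z n"] by (simp flip: z_def)
    \<comment> \<open>Convexity with the tangent taken at z, which bounds the increment of S/p from
      above by \<sigma> Nd z \<phi>.\<close>
    moreover have "Nd (z n) ?y \<le> S (z n) - S (z n) / p + S ?y / p"
      using Nd_Young[OF zH yH] by (simp add: left_diff_distrib)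
    ultimately have S: "S (z n) / p - S ?y / p \<le> \<sigma> n * Nd (z n) \<phi>" by linarith
    have "J ?y \<le> J (z n)"
      using nehari_ray_max[OF w tpos] min[OF N, of n] unfolding z_def by (rule order_trans)
    then have "0 \<le> \<sigma> n * Nd (z n) \<phi> - \<sigma> n * D (\<lambda>x. t n * w x + \<xi> n * \<phi> x) \<phi>"
      using S Phi[of n] unfolding energy_eq by linarith
    then have "0 \<le> \<sigma> n * (Nd (z n) \<phi> - D (\<lambda>x. t n * w x + \<xi> n * \<phi> x) \<phi>)"
      by (simp add: right_diff_distrib)
    then show ?thesis using \<sigma>(1)[of n] by (simp add: zero_le_mult_iff)
  qed
  have "(\<lambda>n. Nd (z n) \<phi>) \<longlonglongrightarrow> Nd (\<lambda>x. 1 * w x + 0 * \<phi> x) \<phi>"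
    unfolding z_def by (intro Nd_tendsto wH \<phi> tlim \<sigma>lim)
  moreover have "(\<lambda>n. D (\<lambda>x. t n * w x + \<xi> n * \<phi> x) \<phi>) \<longlonglongrightarrow> D (\<lambda>x. 1 * w x + 0 * \<phi> x) \<phi>"
    by (intro D_tendsto lp_lim_combine lp_lim_const lp tlim \<xi>lim)
  ultimately have "(\<lambda>n. Nd (z n) \<phi> - D (\<lambda>x. t n * w x + \<xi> n * \<phi> x) \<phi>) \<longlonglongrightarrow> Nd w \<phi> - D w \<phi>"
    using tendsto_diff by fastforce
  then show ?thesis by (rule tendsto_lowerbound) (intro always_eventually allI nonneg, simp)
qed

lemma minimizer_critical:
  assumes w: "w \<in> N" and min: "\<And>v. v \<in> N \<Longrightarrow> J w \<le> J v" and \<phi>: "\<phi> \<in> H"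
  shows "energy_deriv p \<alpha> h f w \<phi> = 0"
proof -
  have wH: "w \<in> H" using w unfolding nehari_iff by auto
  have "Nd w (\<lambda>x. (-1) * \<phi> x) - D w (\<lambda>x. (-1) * \<phi> x) \<ge> 0"
    by (intro minimizer_deriv_nonneg w min H_scale \<phi>)
  moreover have "Nd w (\<lambda>x. (-1) * \<phi> x) = - Nd w \<phi>" using Nd_combine[OF wH \<phi> \<phi>, of "-1" 0] by simp
  moreover have "D w (\<lambda>x. (-1) * \<phi> x) = - D w \<phi>" using D_scale[of w "-1" \<phi>] by simp
  ultimately show ?thesis
    using minimizer_deriv_nonneg[OF w min \<phi>] unfolding energy_deriv_eq by linarith
qed

subsection \<open>The pointwise equation\<close>

lemma D_delta:
  "D u (\<lambda>z. if z = x then 1 else 0) = green_conv \<alpha> (\<lambda>y. F (u y)) x * f (u x)"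
  unfolding D_def kernel_form_def green_conv_def
  by (rule infsumI, rule has_sum_finite_neutralI[of "{x}"]) auto

lemma grad_prod_delta:
  "grad_prod u (\<lambda>z. if z = x then 1 else 0) z =
     (if z = x then - (1/2) * (\<Sum>y | lattice_adj x y. u y - u x)
      else if lattice_adj x z then 1/2 * (u x - u z) else 0)"
proof (cases "z = x")
  case True
  have "\<not> lattice_adj x x" unfolding lattice_adj_def by simp
  then have "(\<Sum>y | lattice_adj x y. (u y - u x) * ((if y = x then 1 else 0) - 1)) = - (\<Sum>y | lattice_adj x y. u y - u x)"
    unfolding sum_negf[symmetric] by (intro sum.cong) auto
  then show ?thesis unfolding grad_prod_def True by simp
next
  case False
  have "(\<Sum>y | lattice_adj z y. (u y - u z) * ((if y = x then 1 else 0) - 0))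
      = (\<Sum>y | lattice_adj z y. if y = x then u x - u z else 0)"
    by (intro sum.cong) auto
  also have "\<dots> = (if lattice_adj z x then u x - u z else 0)"
    by (subst sum.delta) (auto simp: finite_neighbours)
  finally show ?thesis unfolding grad_prod_def using False lattice_adj_sym[of x z] by simp
qed

text \<open>Discrete integration by parts against a unit mass: the density at x yields the |grad
  u|(x) half of the p-Laplacian, the densities at the neighbours y yield the |grad u|(y) half, and
  all others vanish.\<close>

lemma Nd_delta:
  "Nd u (\<lambda>z. if z = x then 1 else 0) = - p_laplacian p u x + h x * \<bar>u x\<bar> powr (p - 2) * u x"
proof -
  let ?d = "\<lambda>z. if z = x then 1 else (0 :: real)" and ?A = "{y. lattice_adj x y}"
  have nx: "x \<notin> ?A" unfolding lattice_adj_def by simp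
  have "Nd u ?d = (\<Sum>z\<in>insert x ?A. Nt u ?d z)"
    unfolding Nd_def
    by (rule infsumI, rule has_sum_finite_neutralI) (auto simp: finite_neighbours Nt_def grad_prod_delta)
  also have "\<dots> = Nt u ?d x + (\<Sum>z\<in>?A. Nt u ?d z)" using nx by (simp add: finite_neighbours)
  also have "Nt u ?d x = - (1/2) * (\<Sum>y\<in>?A. grad_norm u x powr (p - 2) * (u y - u x)) + h x * \<bar>u x\<bar> powr (p - 2) * u x"
    unfolding Nt_def grad_prod_delta by (simp add: sum_distrib_left)
  also have "(\<Sum>z\<in>?A. Nt u ?d z) = (\<Sum>z\<in>?A. - (1/2) * (grad_norm u z powr (p - 2) * (u z - u x)))"
    using nx by (intro sum.cong) (auto simp: Nt_def grad_prod_delta field_simps)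
  also have "\<dots> = - (1/2) * (\<Sum>z\<in>?A. grad_norm u z powr (p - 2) * (u z - u x))"
    by (rule sum_distrib_left[symmetric])
  finally show ?thesis
    unfolding p_laplacian_def by (simp add: distrib_right sum.distrib add_divide_distrib)
qed

lemma ground_state_exists: "\<exists>u. ground_state p \<alpha> h f u \<and> solves_equation p \<alpha> h f u"
proof -
  obtain w where w: "w \<in> N" and min: "\<And>v. v \<in> N \<Longrightarrow> J w \<le> J v" using minimizer by blast
  have crit: "energy_deriv p \<alpha> h f w \<phi> = 0" if "\<phi> \<in> H" for \<phi> by (rule minimizer_critical[OF w min that])
  have "(INF v\<in>N. ereal (J v)) = ereal (J w)" by (rule INF_eqI) (use w min in auto)
  moreover have "w \<in> H - {\<lambda>_. 0}" using w unfolding nehari_iff by auto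
  ultimately have "ground_state p \<alpha> h f w" unfolding ground_state_def using crit by simp
  moreover have "solves_equation p \<alpha> h f w"
    unfolding solves_equation_def
    using crit[OF delta_H] by (simp add: energy_deriv_eq Nd_delta D_delta)
  ultimately show ?thesis by blast
qed

end

theorem theorem1p2:
  fixes p \<alpha> :: real and h :: "int ^ 'n \<Rightarrow> real" and f :: "real \<Rightarrow> real"
  assumes "p \<ge> 2" and "0 < \<alpha>" and "\<alpha> < real CARD('n)"
    and "\<exists>h\<^sub>0>0. \<forall>x. h x \<ge> h\<^sub>0"
    and "\<exists>x\<^sub>0. filterlim h at_top (filtercomap (\<lambda>x. lattice_dist x x\<^sub>0) at_top)"
    and "continuous_on UNIV f"
    and "f \<in> o[at 0](\<lambda>t. \<bar>t\<bar> powr (p - 1))"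
    and "\<exists>C>0. \<exists>\<tau> > (real CARD('n) + \<alpha>) * p / (2 * real CARD('n)).
           \<forall>t. \<bar>f t\<bar> \<le> C * (1 + \<bar>t\<bar> powr (\<tau> - 1))"
    and "\<exists>\<theta>>p. \<forall>t. 0 \<le> \<theta> * primitive f t \<and> \<theta> * primitive f t \<le> 2 * f t * t"
    and "\<forall>u \<in> H_space p h - {\<lambda>_. 0}.
           strict_mono_on {0<..} (\<lambda>t. 1 / t powr p *
             (\<Sum>\<^sub>\<infinity>x. green_conv \<alpha> (\<lambda>y. primitive f (t * u y)) x * f (t * u x) * u x))"
  shows "\<exists>u. ground_state p \<alpha> h f u \<and> solves_equation p \<alpha> h f u"
proof -
  obtain h\<^sub>0 where h0: "h\<^sub>0 > 0" "\<And>x. h x \<ge> h\<^sub>0" using assms(4) by blast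
  obtain x\<^sub>0 where x0: "filterlim h at_top (filtercomap (\<lambda>x. lattice_dist x x\<^sub>0) at_top)" using assms(5) by blast
  obtain B where B: "\<And>x y :: int ^ 'n. \<bar>green \<alpha> x y\<bar> \<le> B" using green_bounded[of \<alpha>] by blast
  interpret choquard \<alpha> B p h\<^sub>0 h f
  proof
    show "\<exists>C>0. \<forall>s. \<bar>s\<bar> \<le> M \<longrightarrow> \<bar>f s\<bar> \<le> C * \<bar>s\<bar> powr (p - 1)" for M
      using assms(1) by (intro smallo_power_bound assms) auto
  qed (use assms(1,6) B green_sym h0 coercive_finite_sublevel[OF x0] in auto)
  interpret nehari_choquard \<alpha> B p h\<^sub>0 h f
  proof
    show "strict_mono_on {0<..} (\<lambda>t. D (\<lambda>x. t * u x) u / t powr p)"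
      if "u \<in> H_space p h" "u \<noteq> (\<lambda>_. 0)" for u
      using assms(10) that
      by (simp add: D_def kernel_form_def green_conv_def mult.assoc)
  qed
  show ?thesis by (rule ground_state_exists)
qed

end
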